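(* Let $m\ge1$ and write $m^+=m+1$. Let $Z$ be the unique formal power series in $t$ with constant term $0$ such that $t=Z(1-m^+Z)^m$, and let $U$ be the unique formal power series in $t$ with coefficients in $\mathbb{Q}[x]$ such that \[ x=\frac{U}{1-m^+Z}\left(1-Z\,\frac{U^{m+1}-1}{U-1}\right). \] Then the generating function $I$ of greedy $m$-Tamari intervals of positive size, counted by size (variable $t$) and final descent length of the maximal element (variable $x$), is given by \[ x^2 I=\frac{Z U^{m+2}}{(1-m^+Z)^2}\left(1-Z\sum_{e=0}^m U^e(m+1-e)\right)=\frac{ZU^{m+2}}{1-m^+Z}\cdot\frac{x-1}{U-1}. \] In particular \[ I(1)=\frac{Z}{(1-m^+Z)^2}\left(1-\binom{m+2}{2}Z\right). \] More generally, for $0\le i\le m+1$, the generating function $J_i$ of the set $\mathcal J_i$ satisfies \[ \frac{J_i}{x^{m-i-1}}=Z(1-m^+Z)^{m-i-1}H_i(Z;U), \] where $H_i(z;u)$ are the polynomials \[ H_{m+1}(z;u)=u^{m+2}\left(1-z\sum_{e=0}^m u^e(m+1-e)\right), \] and, for $0\le i\le m$, \[ H_i(z;u)=u^{i+1}\left(1+\sum_{k=1}^{i+1}(-z)^k\binom{i+1}{k}\sum_{e=0}^{m-i}\binom{e+k-1}{e}u^e+\sum_{k=1}^{i}(-z)^k\binom{m+k-i-1}{k-1}\sum_{e=0}^{i-k}\binom{e+k}{e}u^{m+1-k-e}\right). \]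
   Context: An $m$-Dyck path of size $n$ is a word with $n$ letters $1$ (up steps $(+m,+m)$) and $mn$ letters $0$ (down steps $(+1,-1)$) whose lattice path from $(0,0)$ never goes strictly below the horizontal axis; $\varnothing$ denotes the empty path. The final descent length $d(w)$ is the length $k$ of the longest suffix $0^k$ of $w$. A valley is an occurrence of $01$; a Dyck factor is a factor which is itself an $m$-Dyck path. The greedy $m$-Tamari order is generated by the cover relations $w\triangleleft w'$, one per valley of $w$, where $w'$ is obtained by swapping the down step of the valley with the longest Dyck factor immediately following it. An interval $[v,w]$ is a pair of paths of the same size $n$ with $v\le w$; generating functions weight it by $t^nx^{d(w)}$, and $F(1)$ denotes specialisation at $x=1$. $D(w_1,\dots,w_{m+1})$ denotes $1w_10\,w_20\cdots w_m0\,w_{m+1}$. For $0\le i\le m+1$, $\mathcal J_i$ is the set of greedy intervals $[v,w]$ of positive size with $v=D(v_1,\dots,v_i,\varnothing,\dots,\varnothing)$ for some (possibly empty) $m$-Dyck paths $v_1,\dots,v_i$; $J_i$ is its generating function (so $\mathcal J_0=\{[10^m,10^m]\}$ and $J_{m+1}=I$). *)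

theory Defs
  imports
    "HOL-Library.Sublist"
    "HOL-Computational_Algebra.Computational_Algebra"
begin

section \<open>Dyck paths and the greedy Tamari order\<close>

text \<open>The letters 1 and 0 are rendered as \<open>Up\<close> and \<open>Down\<close>.\<close>

datatype step = Up | Down

text \<open>
  The height after reading \<open>w\<close> is \<open>m * count_list w Up - count_list w Down\<close>. Since steps are
  straight segments, a path stays weakly above the axis iff the height of every prefix is
  nonnegative.
\<close>

definition dyck :: "nat \<Rightarrow> step list \<Rightarrow> bool" where
  "dyck m w \<longleftrightarrow>
     count_list w Down = m * count_list w Up \<and>
     (\<forall>p. prefix p w \<longrightarrow> 0 \<le> int m * int (count_list p Up) - int (count_list p Down))"

definition path_size :: "step list \<Rightarrow> nat" where
  "path_size w = count_list w Up"

definition final_descent :: "step list \<Rightarrow> nat" where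
  "final_descent w = length (takeWhile (\<lambda>s. s = Down) (rev w))"

definition longest_dyck_prefix :: "nat \<Rightarrow> step list \<Rightarrow> step list \<Rightarrow> bool" where
  "longest_dyck_prefix m s f \<longleftrightarrow>
     prefix f s \<and> dyck m f \<and> (\<forall>g. prefix g s \<and> dyck m g \<longrightarrow> length g \<le> length f)"

text \<open>
  In \<open>a @ Down # Up # c\<close> the displayed letters are the valley, and \<open>f\<close> is the longest Dyck factor
  starting right after its down step.
\<close>

definition greedy_cover :: "nat \<Rightarrow> step list \<Rightarrow> step list \<Rightarrow> bool" where
  "greedy_cover m w w' \<longleftrightarrow>
     dyck m w \<and>
     (\<exists>a c f b. w = a @ Down # Up # c \<and> Up # c = f @ b \<and>
        longest_dyck_prefix m (Up # c) f \<and> w' = a @ f @ Down # b)"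

definition greedy_le :: "nat \<Rightarrow> step list \<Rightarrow> step list \<Rightarrow> bool" where
  "greedy_le m = (greedy_cover m)\<^sup>*\<^sup>*"

definition greedy_intervals :: "nat \<Rightarrow> (step list \<times> step list) set" where
  "greedy_intervals m =
     {(v, w). dyck m v \<and> dyck m w \<and> path_size v = path_size w \<and> greedy_le m v w}"

definition pos_intervals :: "nat \<Rightarrow> (step list \<times> step list) set" where
  "pos_intervals m = {(v, w) \<in> greedy_intervals m. 0 < path_size v}"

text \<open>
  For a list \<open>[w\<^sub>1, \<dots>, w\<^sub>m\<^sub>+\<^sub>1]\<close> this is the word \<open>1 w\<^sub>1 0 w\<^sub>2 0 \<dots> w\<^sub>m 0 w\<^sub>m\<^sub>+\<^sub>1\<close>; no letter 0
  follows the last factor.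
\<close>

definition D_path :: "step list list \<Rightarrow> step list" where
  "D_path ws = Up # concat (map (\<lambda>w. w @ [Down]) (butlast ws)) @ last ws"

definition J_set :: "nat \<Rightarrow> nat \<Rightarrow> (step list \<times> step list) set" where
  "J_set m i =
     {(v, w) \<in> pos_intervals m.
        \<exists>vs. length vs = i \<and> (\<forall>u \<in> set vs. dyck m u) \<and>
             v = D_path (vs @ replicate (m + 1 - i) [])}"


section \<open>Generating functions\<close>

text \<open>
  The outer series variable is \<open>t\<close>, the inner polynomial variable is \<open>x\<close>. Only finitely many pairs
  of \<open>m\<close>-Dyck paths have a given size, so for sets of intervals the sums below are finite.
\<close>

definition gf :: "(step list \<times> step list) set \<Rightarrow> rat poly fps" where
  "gf S = Abs_fps (\<lambda>n. \<Sum>(v, w) \<in> {(v, w) \<in> S. path_size v = n}. monom 1 (final_descent w))"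

definition I_gf :: "nat \<Rightarrow> rat poly fps" where
  "I_gf m = gf (pos_intervals m)"

definition J_gf :: "nat \<Rightarrow> nat \<Rightarrow> rat poly fps" where
  "J_gf m i = gf (J_set m i)"

definition at_x1 :: "rat poly fps \<Rightarrow> rat fps" where
  "at_x1 F = Abs_fps (\<lambda>n. poly (fps_nth F n) 1)"

text \<open>
  Identities involving quotients are stated in the fraction field of \<open>\<rat>[x][[t]]\<close>, because
  \<open>U - 1\<close> and \<open>x\<close> are nonzero but not invertible in \<open>\<rat>[x][[t]]\<close> itself. The maps \<open>emb\<close> and
  \<open>embZ\<close> are the inclusions of \<open>\<rat>[x][[t]]\<close> and \<open>\<rat>[[t]]\<close> into this field.
\<close>

type_synonym frac_series = "rat poly fps fract"

definition emb :: "rat poly fps \<Rightarrow> frac_series" where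
  "emb F = Fraction_Field.Fract F 1"

definition embZ :: "rat fps \<Rightarrow> frac_series" where
  "embZ F = emb (Abs_fps (\<lambda>n. [:fps_nth F n:]))"

definition X :: frac_series where
  "X = emb (fps_const [:0, 1:])"

definition is_Z :: "nat \<Rightarrow> rat fps \<Rightarrow> bool" where
  "is_Z m Z \<longleftrightarrow> fps_nth Z 0 = 0 \<and> fps_X = Z * (1 - of_nat (m + 1) * Z) ^ m"

definition is_U :: "nat \<Rightarrow> rat fps \<Rightarrow> rat poly fps \<Rightarrow> bool" where
  "is_U m Z U \<longleftrightarrow>
     X = emb U / (1 - of_nat (m + 1) * embZ Z) *
         (1 - embZ Z * ((emb U ^ (m + 1) - 1) / (emb U - 1)))"

text \<open>
  For \<open>i \<le> m + 1\<close>, the value at \<open>(z, u)\<close> of the polynomial \<open>H\<^sub>i\<close>. Every natural-number subtraction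
  below is genuine on the range of summation.
\<close>

definition H :: "nat \<Rightarrow> nat \<Rightarrow> 'a::comm_ring_1 \<Rightarrow> 'a \<Rightarrow> 'a" where
  "H m i z u =
     (if i = m + 1 then
        u ^ (m + 2) * (1 - z * (\<Sum>e=0..m. u ^ e * of_nat (m + 1 - e)))
      else
        u ^ (i + 1) *
        (1 + (\<Sum>k=1..i + 1. (- z) ^ k * of_nat ((i + 1) choose k) *
                (\<Sum>e=0..m - i. of_nat ((e + k - 1) choose e) * u ^ e))
           + (\<Sum>k=1..i. (- z) ^ k * of_nat ((m + k - i - 1) choose (k - 1)) *
                (\<Sum>e=0..i - k. of_nat ((e + k) choose e) * u ^ (m + 1 - k - e)))))"

end

theory Submission
  imports Defs
begin

text \<open>
  Write \<open>v = D(v\<^sub>1, \<dots>, v\<^sub>i, \<emptyset>, \<dots>, \<emptyset>)\<close> with \<open>v\<^sub>i\<close> nonempty as the path \<open>v' = D(v\<^sub>1, \<dots>, v\<^sub>i\<^sub>-\<^sub>1, \<emptyset>, \<dots>, \<emptyset>)\<close>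
  with \<open>v\<^sub>i\<close> inserted into its last descent at height \<open>m + 1 - i\<close>. All valleys of \<open>v'\<close> lie above that
  height, so the greedy covers act independently on \<open>v'\<close>, on \<open>v\<^sub>i\<close> and on the insertion height, which can
  only grow: the elements above \<open>v\<close> are exactly the paths obtained by inserting some \<open>w\<^sub>i \<ge> v\<^sub>i\<close> into the
  last descent of some \<open>w' \<ge> v'\<close> at a height \<open>k \<ge> m + 1 - i\<close>. The last descent of the result has length
  \<open>k + d(w\<^sub>i)\<close>, which gives
  \<open>J\<^sub>i = J\<^sub>i\<^sub>-\<^sub>1 + I (x J\<^sub>i\<^sub>-\<^sub>1 - x\<^sup>m\<^sup>+\<^sup>1\<^sup>-\<^sup>i J\<^sub>i\<^sub>-\<^sub>1(1)) / (x - 1)\<close>, with \<open>J\<^sub>0 = t x\<^sup>m\<close> and \<open>J\<^sub>m\<^sub>+\<^sub>1 = I\<close>.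

  This system determines all its members coefficient by coefficient in \<open>t\<close>. That the claimed series solve
  it reduces, as \<open>U = 1\<close> at \<open>x = 1\<close>, to the polynomial identity
  \<open>(u - 1) H\<^sub>i = u (u - 1) H\<^sub>i\<^sub>-\<^sub>1 + z u (H\<^sub>i\<^sub>-\<^sub>1(u) - u\<^sup>m\<^sup>+\<^sup>1 H\<^sub>i\<^sub>-\<^sub>1(1))\<close>, which is Pascal's rule for all but
  one power of \<open>u\<close> and follows for the remaining one by setting \<open>u = 1\<close>.
\<close>

section \<open>Heights and greedy covers\<close>

definition height :: "nat \<Rightarrow> step list \<Rightarrow> int" where
  "height m w = int m * int (count_list w Up) - int (count_list w Down)"

lemma height_simps [simp]:
  "height m [] = 0"
  "height m (Up # w) = int m + height m w"
  "height m (Down # w) = height m w - 1"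
  "height m (a @ b) = height m a + height m b"
  by (simp_all add: height_def algebra_simps)

lemma height_replicate_Down [simp]: "height m (replicate k Down) = - int k"
  by (induction k) auto

definition nonneg :: "nat \<Rightarrow> step list \<Rightarrow> bool" where
  "nonneg m w \<longleftrightarrow> (\<forall>p. prefix p w \<longrightarrow> 0 \<le> height m p)"

lemma dyck_iff: "dyck m w \<longleftrightarrow> height m w = 0 \<and> nonneg m w"
proof -
  have "count_list w Down = m * count_list w Up \<longleftrightarrow> height m w = 0"
    unfolding height_def by (metis eq_iff_diff_eq_0 of_nat_eq_iff of_nat_mult)
  then show ?thesis by (simp add: dyck_def nonneg_def height_def)
qed

lemma nonneg_append:
  "nonneg m (a @ b) \<longleftrightarrow> nonneg m a \<and> (\<forall>p. prefix p b \<longrightarrow> 0 \<le> height m a + height m p)"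
  unfolding nonneg_def prefix_append by (metis height_simps(4))

lemma nonnegD: "nonneg m w \<Longrightarrow> prefix p w \<Longrightarrow> 0 \<le> height m p"
  by (simp add: nonneg_def)

lemma nonneg_height: "nonneg m w \<Longrightarrow> 0 \<le> height m w"
  by (simp add: nonneg_def)

lemma dyck_height: "dyck m w \<Longrightarrow> height m w = 0"
  by (simp add: dyck_iff)

lemma dyck_Nil [simp]: "dyck m []"
  by (simp add: dyck_iff nonneg_def)

lemma dyck_nonempty:
  assumes "dyck m w" "w \<noteq> []"
  obtains w' where "w = Up # w'"
proof (cases w)
  case (Cons x w')
  show ?thesis
  proof (cases x)
    case Down
    then have "prefix [Down] w" using Cons by simp
    with assms(1) show ?thesis by (auto simp: dyck_iff dest: nonnegD)
  qed (use Cons that in auto)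
qed (use assms in auto)

lemma prefix_replicate_iff: "prefix p (replicate k x) \<longleftrightarrow> (\<exists>j\<le>k. p = replicate j x)"
proof
  assume "prefix p (replicate k x)"
  then obtain r where "replicate k x = p @ r" by (auto simp: prefix_def)
  then show "\<exists>j\<le>k. p = replicate j x"
    by (metis append_eq_conv_conj length_append length_replicate linorder_linear min.absorb2
        nat_le_iff_add take_replicate)
next
  assume "\<exists>j\<le>k. p = replicate j x"
  then show "prefix p (replicate k x)"
    by (metis le_add_diff_inverse prefixI replicate_add)
qed

lemma nonneg_append_Downs:
  "nonneg m (a @ replicate k Down) \<longleftrightarrow> nonneg m a \<and> int k \<le> height m a"
  by (auto simp: nonneg_append prefix_replicate_iff)

text \<open>A Dyck factor never falls below its starting height and returns to it, so inserting or
  removing it leaves all other heights unchanged.\<close>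

lemma nonneg_insert_dyck:
  assumes "dyck m s"
  shows "nonneg m (a @ s @ b) \<longleftrightarrow> nonneg m (a @ b)"
proof -
  have "0 \<le> height m a + height m p" if "nonneg m a" "prefix p s" for p
    using that assms nonneg_height[OF that(1)] nonnegD[of m s p] by (simp add: dyck_iff)
  then show ?thesis
    using assms by (auto simp: nonneg_append dyck_iff prefix_append)
qed

lemma dyck_insert_dyck:
  assumes "dyck m s"
  shows "dyck m (a @ s @ b) \<longleftrightarrow> dyck m (a @ b)"
  using nonneg_insert_dyck[OF assms, of a b] assms by (simp add: dyck_iff)

section \<open>Longest Dyck prefixes and the covers they define\<close>

lemma longest_dyck_prefix_unique:
  assumes "longest_dyck_prefix m s f" "longest_dyck_prefix m s g"
  shows "f = g"
proof -
  have "length f = length g"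
    using assms by (auto simp: longest_dyck_prefix_def intro: le_antisym)
  then show ?thesis
    using assms by (auto simp: longest_dyck_prefix_def prefix_def append_eq_append_conv)
qed

lemma prefix_append_le_length:
  "prefix g (s @ t) \<Longrightarrow> length g \<le> length s \<Longrightarrow> prefix g s"
  by (meson prefixI prefix_length_prefix)

lemma longest_dyck_prefix_append:
  assumes "\<And>g. prefix g (s @ t) \<Longrightarrow> dyck m g \<Longrightarrow> length g \<le> length s"
  shows "longest_dyck_prefix m (s @ t) f \<longleftrightarrow> longest_dyck_prefix m s f"
  using assms unfolding longest_dyck_prefix_def
  by (metis prefix_append_le_length prefix_prefix)

text \<open>A path that has gone below the axis is no prefix of a Dyck path, so whatever follows
  \<open>s\<close> is out of reach.\<close>

lemma longest_dyck_prefix_append_neg: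
  assumes "\<not> nonneg m s"
  shows "longest_dyck_prefix m (s @ t) f \<longleftrightarrow> longest_dyck_prefix m s f"
proof (rule longest_dyck_prefix_append)
  fix g assume g: "prefix g (s @ t)" "dyck m g"
  show "length g \<le> length s"
  proof (rule ccontr)
    assume "\<not> length g \<le> length s"
    then have "prefix s g"
      using g(1) by (metis linorder_linear prefixI prefix_length_prefix)
    then show False using assms g(2)
      by (metis dyck_iff nonneg_def prefix_order.trans)
  qed
qed

lemma longest_dyck_prefix_append_Downs:
  assumes "height m s \<le> 0"
  shows "longest_dyck_prefix m (s @ replicate k Down) f \<longleftrightarrow> longest_dyck_prefix m s f"
proof (rule longest_dyck_prefix_append)
  fix g assume g: "prefix g (s @ replicate k Down)" "dyck m g"
  show "length g \<le> length s"
    using g assms by (auto simp: prefix_append prefix_replicate_iff dyck_iff prefix_length_le)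
qed

text \<open>The longest Dyck prefix ends where the descent meets the axis, after exactly
  \<open>h\<close> of its steps; every later point lies below the axis.\<close>

lemma longest_dyck_prefix_descent:
  assumes "nonneg m s" "height m s = int h" "h \<le> k"
  shows "longest_dyck_prefix m (s @ replicate k Down) (s @ replicate h Down)"
proof -
  have "dyck m (s @ replicate h Down)"
    using assms by (simp add: dyck_iff nonneg_append_Downs)
  moreover have "length g \<le> length (s @ replicate h Down)"
    if "prefix g (s @ replicate k Down)" "dyck m g" for g
    using that assms by (auto simp: prefix_append prefix_replicate_iff dyck_iff dest: prefix_length_le)
  ultimately show ?thesis
    using assms by (auto simp: longest_dyck_prefix_def prefix_append prefix_replicate_iff)
qed

lemma greedy_coverI:
  assumes "dyck m w" "w = a @ Down # Up # c" "Up # c = f @ b"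
    "longest_dyck_prefix m (Up # c) f" "w' = a @ f @ Down # b"
  shows "greedy_cover m w w'"
  using assms unfolding greedy_cover_def by blast

lemma greedy_coverE:
  assumes "greedy_cover m w w'"
  obtains a c f b where "dyck m w" "w = a @ Down # Up # c" "Up # c = f @ b"
    "longest_dyck_prefix m (Up # c) f" "w' = a @ f @ Down # b"
  using assms unfolding greedy_cover_def by blast

text \<open>Both paths arise by inserting the Dyck path \<open>f\<close> into the same word
  \<open>a @ Down # b\<close>: after the down step for \<open>w\<close>, before it for
  \<open>w'\<close>.\<close>

lemma greedy_cover_dyck:
  assumes "greedy_cover m w w'"
  shows "dyck m w'" "path_size w' = path_size w"
proof -
  from assms obtain a c f b where *: "dyck m w" "w = a @ Down # Up # c" "Up # c = f @ b"
    "longest_dyck_prefix m (Up # c) f" "w' = a @ f @ Down # b"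
    by (rule greedy_coverE)
  have f: "dyck m f" using *(4) by (simp add: longest_dyck_prefix_def)
  have w: "w = (a @ [Down]) @ f @ b" using * by simp
  have "dyck m (a @ Down # b)"
    using *(1) dyck_insert_dyck[OF f, of "a @ [Down]" b] w by simp
  then show "dyck m w'" using dyck_insert_dyck[OF f, of a "Down # b"] * by simp
  show "path_size w' = path_size w" using * w by (simp add: path_size_def)
qed

lemma greedy_le_dyck:
  assumes "greedy_le m v w" "dyck m v"
  shows "dyck m w" "path_size w = path_size v"
proof -
  have "dyck m w \<and> path_size w = path_size v"
    using assms unfolding greedy_le_def
    by (induction rule: rtranclp_induct) (auto dest: greedy_cover_dyck)
  then show "dyck m w" "path_size w = path_size v" by auto
qed

lemma greedy_intervals_iff:
  "(v, w) \<in> greedy_intervals m \<longleftrightarrow> dyck m v \<and> greedy_le m v w"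
  unfolding greedy_intervals_def using greedy_le_dyck[of m v w] by auto

text \<open>The down step of a valley of \<open>s\<close> ends at nonnegative height within
  \<open>s\<close>. The rest of \<open>s\<close> therefore has nonpositive total height, and
  appended down steps do not lengthen the Dyck factor that the cover moves.\<close>

lemma greedy_cover_in_descent:
  assumes "greedy_cover m s s'" "dyck m (a @ replicate k Down)"
  shows "greedy_cover m (a @ s @ replicate k Down) (a @ s' @ replicate k Down)"
proof -
  from assms obtain A c f b where *: "dyck m s" "s = A @ Down # Up # c" "Up # c = f @ b"
    "longest_dyck_prefix m (Up # c) f" "s' = A @ f @ Down # b"
    by (auto elim: greedy_coverE)
  have "prefix (A @ [Down]) s" using *(2) by simp
  then have "0 \<le> height m (A @ [Down])" using *(1) dyck_iff nonnegD by blast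
  then have "height m (Up # c) \<le> 0" using dyck_height[OF *(1)] *(2) by simp
  note longest_dyck_prefix_append_Downs[OF this, of k f]
  then have l: "longest_dyck_prefix m (Up # c @ replicate k Down) f" using *(4) by simp
  have "dyck m (a @ s @ replicate k Down)"
    using dyck_insert_dyck[OF *(1)] assms(2) by blast
  then show ?thesis
    by (rule greedy_coverI[OF _ _ _ l, of _ "a @ A" "b @ replicate k Down"])
      (use * in \<open>simp_all flip: append_Cons append_assoc\<close>)
qed

lemma greedy_le_in_descent:
  assumes "greedy_le m s s'" "dyck m (a @ replicate k Down)"
  shows "greedy_le m (a @ s @ replicate k Down) (a @ s' @ replicate k Down)"
  using assms(1) unfolding greedy_le_def
proof (induction rule: rtranclp_induct)
  case (step y z)
  then show ?case using greedy_cover_in_descent[OF step(2) assms(2)] by simp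
qed simp

text \<open>Followed only by down steps, \<open>s\<close> is itself the longest Dyck factor after
  the preceding down step, so the cover moves it up by one level in the descent.\<close>

lemma greedy_cover_shift:
  assumes "dyck m s" "s \<noteq> []" "dyck m (a @ Down # replicate k Down)"
  shows "greedy_cover m (a @ Down # s @ replicate k Down) (a @ s @ Down # replicate k Down)"
proof -
  obtain c where c: "s = Up # c" using assms dyck_nonempty by blast
  have "longest_dyck_prefix m (s @ replicate k Down) (s @ replicate 0 Down)"
    using assms(1) by (intro longest_dyck_prefix_descent) (auto simp: dyck_iff)
  moreover have "dyck m (a @ Down # s @ replicate k Down)"
    using dyck_insert_dyck[OF assms(1), of "a @ [Down]" "replicate k Down"] assms(3) by simp
  ultimately show ?thesis
    using c by (intro greedy_coverI[of m _ a "c @ replicate k Down" s "replicate k Down"]) auto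
qed

lemma greedy_le_shift:
  assumes "dyck m s" "s \<noteq> []" "dyck m (a @ replicate j Down @ replicate k Down)"
  shows "greedy_le m (a @ replicate j Down @ s @ replicate k Down)
           (a @ s @ replicate j Down @ replicate k Down)"
  using assms(3)
proof (induction j arbitrary: k)
  case (Suc j)
  have e: "replicate (Suc j) Down @ y = replicate j Down @ Down # y" for y
    by (simp add: replicate_app_Cons_same)
  have "greedy_cover m (a @ replicate (Suc j) Down @ s @ replicate k Down)
          (a @ replicate j Down @ s @ replicate (Suc k) Down)"
    using greedy_cover_shift[OF assms(1,2), of "a @ replicate j Down" k] Suc.prems unfolding e by simp
  moreover have "greedy_le m (a @ replicate j Down @ s @ replicate (Suc k) Down)
          (a @ s @ replicate j Down @ replicate (Suc k) Down)"
    using Suc.prems by (intro Suc.IH) (simp add: replicate_app_Cons_same)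
  ultimately show ?case
    unfolding e by (simp add: greedy_le_def converse_rtranclp_into_rtranclp)
qed (simp add: greedy_le_def)

section \<open>Dyck paths inserted into a last descent\<close>

text \<open>The cases are the possible positions of the valley and its Dyck factor: both in
  \<open>s\<close>; the valley formed by the last step of \<open>a\<close> and the first step of
  \<open>s\<close>; both in \<open>a\<close>; or the valley in \<open>a\<close> with a factor that
  swallows \<open>s\<close>. In the last case the factor ends at a point of the last descent, and
  the moved down step joins that descent, whose length grows by one.\<close>

lemma greedy_cover_insertion_cases:
  assumes cov: "greedy_cover m (a @ s @ replicate k Down) u"
    and a: "dyck m (a @ replicate k Down)" and s: "dyck m s" "s \<noteq> []"
  obtains
    (inside) s' where "greedy_cover m s s'" "u = a @ s' @ replicate k Down"
  | (shift) a' where "a = a' @ [Down]" "u = a' @ s @ replicate (Suc k) Down"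
  | (outside) a' where "greedy_cover m (a @ replicate k Down) (a' @ replicate k Down)"
      "u = a' @ s @ replicate k Down"
  | (around) a' where "greedy_cover m (a @ replicate k Down) (a' @ replicate (Suc k) Down)"
      "u = a' @ s @ replicate (Suc k) Down"
proof -
  from cov obtain A c f b where *: "dyck m (a @ s @ replicate k Down)"
    "a @ s @ replicate k Down = A @ Down # Up # c" "Up # c = f @ b"
    "longest_dyck_prefix m (Up # c) f" "u = A @ f @ Down # b"
    by (rule greedy_coverE)
  obtain s0 where s0: "s = Up # s0" using s dyck_nonempty by blast
  have f: "dyck m f" using *(4) by (simp add: longest_dyck_prefix_def)
  from *(2) consider
      (1) r where "A = a @ r" "s @ replicate k Down = r @ Down # Up # c"
    | (2) r where "a = A @ Down # r" "Up # c = r @ s @ replicate k Down"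
    unfolding append_eq_append_conv2[of a]
    by (metis append.right_neutral append_Cons append_Nil list.exhaust list.inject append_eq_Cons_conv)
  then show thesis
  proof cases
    case 1
    \<comment> \<open>The trailing descent contains no up step, so the whole valley lies in
      \<open>s\<close>.\<close>
    from 1(2) obtain c' where c': "s = r @ Down # Up # c'" "c = c' @ replicate k Down"
    proof -
      have "\<not> prefix s r"
      proof
        assume "prefix s r"
        then obtain q where "r = s @ q" by (auto simp: prefix_def)
        then have "replicate k Down = q @ Down # Up # c" using 1(2) by simp
        then have "Up \<in> set (replicate k Down)" by simp
        then show False by (auto split: if_splits)
      qed
      then obtain q where q: "s = r @ q" "q \<noteq> []" "q @ replicate k Down = Down # Up # c"
        using 1(2) by (auto simp: append_eq_append_conv2)
      then obtain q' where q': "q = Down # q'" "q' @ replicate k Down = Up # c"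
        by (cases q) auto
      have "q' \<noteq> []"
      proof
        assume "q' = []"
        then have "Up \<in> set (replicate k Down)" using q'(2) by simp
        then show False by (auto split: if_splits)
      qed
      then obtain c' where "q' = Up # c'" "c = c' @ replicate k Down" using q'(2) by (cases q') auto
      then show thesis using q q' by (intro that) auto
    qed
    have "prefix (r @ [Down]) s" using c' by simp
    then have "0 \<le> height m (r @ [Down])" using s by (auto simp: dyck_iff dest: nonnegD)
    then have "height m (Up # c') \<le> 0" using dyck_height[OF s(1)] c' by simp
    from longest_dyck_prefix_append_Downs[OF this, of k f] *(4) c'
    have l: "longest_dyck_prefix m (Up # c') f" by simp
    then obtain b' where b': "Up # c' = f @ b'" by (auto simp: longest_dyck_prefix_def prefix_def)
    then have "f @ b = f @ b' @ replicate k Down" using *(3) c'(2) by (metis append_Cons append_assoc)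
    then have "b = b' @ replicate k Down" by simp
    with b' l c' s * 1 show thesis
      by (intro inside[of "r @ f @ Down # b'"] greedy_coverI[of m s r c' f b']) auto
  next
    case 2
    show thesis
    proof (cases r)
      case Nil
      have "longest_dyck_prefix m (s @ replicate k Down) (s @ replicate 0 Down)"
        using s(1) by (intro longest_dyck_prefix_descent) (auto simp: dyck_iff)
      then have "f = s" using longest_dyck_prefix_unique *(4) 2(2) Nil by fastforce
      then have "b = replicate k Down" using 2(2) *(3) Nil by simp
      with \<open>f = s\<close> show thesis using 2 * Nil by (intro shift[of A]) auto
    next
      case (Cons x C)
      then have x: "x = Up" "c = C @ s @ replicate k Down" using 2(2) by auto
      have a': "a @ replicate k Down = A @ Down # Up # C @ replicate k Down"
        using 2 Cons x by simp
      show thesis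
      proof (cases "nonneg m r")
        \<comment> \<open>The segment \<open>r\<close> between the valley's down step and
          \<open>s\<close> falls below its starting height, so the factor ends before
          \<open>s\<close> and is the same with \<open>s\<close> removed.\<close>
        case False
        have l: "longest_dyck_prefix m r f"
          using *(4) 2(2) longest_dyck_prefix_append_neg[OF False] by simp
        then have l': "longest_dyck_prefix m (r @ replicate k Down) f"
          using longest_dyck_prefix_append_neg[OF False] by simp
        then have l'': "longest_dyck_prefix m (Up # C @ replicate k Down) f"
          using Cons x by simp
        obtain b' where b': "r = f @ b'" using l by (auto simp: longest_dyck_prefix_def prefix_def)
        then have "b = b' @ s @ replicate k Down" using *(3) 2(2) by simp
        moreover have "greedy_cover m (a @ replicate k Down) ((A @ f @ Down # b') @ replicate k Down)"
          by (rule greedy_coverI[OF a a' _ l'', of "b' @ replicate k Down"])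
            (use b' Cons x in \<open>simp_all flip: append_Cons append_assoc\<close>)
        ultimately show thesis using * by (intro outside[of "A @ f @ Down # b'"]) auto
      next
        case True
        \<comment> \<open>Otherwise the factor contains \<open>r\<close> and \<open>s\<close> and
          needs \<open>h\<close> more down steps to return to its starting height.\<close>
        define h where "h = nat (height m r)"
        have h: "height m r = int h" using nonneg_height[OF True] by (simp add: h_def)
        have "prefix (A @ [Down]) (a @ replicate k Down)" using 2 by simp
        then have "0 \<le> height m (A @ [Down])" using a by (auto simp: dyck_iff dest: nonnegD)
        then have "h \<le> k" using dyck_height[OF a] 2(1) h by simp
        have "longest_dyck_prefix m ((r @ s) @ replicate k Down) ((r @ s) @ replicate h Down)"
          using True h s \<open>h \<le> k\<close> nonneg_insert_dyck[OF s(1), of r "[]"]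
          by (intro longest_dyck_prefix_descent) (auto simp: dyck_iff)
        then have f': "f = r @ s @ replicate h Down"
          using longest_dyck_prefix_unique *(4) 2(2) by fastforce
        have k: "replicate k Down = replicate h Down @ replicate (k - h) Down"
          using \<open>h \<le> k\<close> by (metis le_add_diff_inverse replicate_add)
        have "b = replicate (k - h) Down" using *(3) 2(2) f' k by simp
        then have "Down # b = Down # replicate (k - h) Down" by simp
        have e: "replicate h Down @ Down # replicate (k - h) Down = replicate (Suc k) Down"
          using k by (metis append_Cons replicate_Suc replicate_app_Cons_same)
        have "longest_dyck_prefix m (r @ replicate k Down) (r @ replicate h Down)"
          by (intro longest_dyck_prefix_descent True h \<open>h \<le> k\<close>)
        then have "greedy_cover m (a @ replicate k Down) ((A @ r) @ replicate (Suc k) Down)"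
          using a a' 2 Cons x k e
          by (intro greedy_coverI[of m _ A "C @ replicate k Down" "r @ replicate h Down"
                "replicate (k - h) Down"]) auto
        then show thesis
          using * f' e \<open>b = _\<close> by (intro around[of "A @ r"]) auto
      qed
    qed
  qed
qed

text \<open>
  All valleys of a path \<open>a @ replicate k Down\<close> with \<open>deep m k a\<close> lie above height \<open>k\<close>, so no cover reaches
  around a Dyck path inserted at height \<open>k\<close>.
\<close>

definition deep :: "nat \<Rightarrow> nat \<Rightarrow> step list \<Rightarrow> bool" where
  "deep m k a \<longleftrightarrow> (\<forall>p. strict_prefix p a \<and> p \<noteq> [] \<longrightarrow> int k < height m p)"

text \<open>The valley lies above height \<open>k\<close>, while the whole of \<open>a\<close> ends
  at height \<open>k\<close>; so the part of \<open>a\<close> after the valley's down step has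
  negative total height. The moved factor thus ends inside \<open>a\<close>, and the same cover
  exists with \<open>s\<close> present. Heights rise by one along the moved factor and are unchanged
  elsewhere, so \<open>deep\<close> persists.\<close>

lemma greedy_cover_outside:
  assumes cov: "greedy_cover m (a @ replicate k Down) y" and a: "deep m k a" and s: "dyck m s"
  obtains a' where "y = a' @ replicate k Down" "deep m k a'"
    "greedy_cover m (a @ s @ replicate k Down) (a' @ s @ replicate k Down)"
proof -
  from cov obtain A c f b where *: "dyck m (a @ replicate k Down)"
    "a @ replicate k Down = A @ Down # Up # c" "Up # c = f @ b"
    "longest_dyck_prefix m (Up # c) f" "y = A @ f @ Down # b"
    by (rule greedy_coverE)
  have f: "dyck m f" using *(4) by (simp add: longest_dyck_prefix_def)
  obtain C where C: "a = A @ Down # Up # C" "c = C @ replicate k Down"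
  proof -
    have "(A @ [Down, Up]) @ c = a @ replicate k Down" using *(2) by simp
    then obtain q where "a = (A @ [Down, Up]) @ q \<and> c = q @ replicate k Down \<or>
        A @ [Down, Up] = a @ q \<and> q @ c = replicate k Down"
      unfolding append_eq_append_conv2 by blast
    then consider "a = (A @ [Down, Up]) @ q" "c = q @ replicate k Down"
      | "A @ [Down, Up] = a @ q" "q @ c = replicate k Down" "q \<noteq> []"
      by (cases q) auto
    then show thesis
    proof cases
      case 2
      then have "last q = Up" by (metis last.simps last_append list.distinct(1))
      then have "Up \<in> set (q @ c)" using last_in_set[OF 2(3)] by simp
      then show thesis unfolding 2(2) by (auto split: if_splits)
    qed (use that in auto)
  qed
  have "strict_prefix (A @ [Down]) a" using C by (simp add: strict_prefix_def)
  then have hA: "int k < height m (A @ [Down])" using a unfolding deep_def by blast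
  have neg: "\<not> nonneg m (Up # C)"
    using hA nonneg_height[of m "Up # C"] dyck_height[OF *(1)] C by auto
  have l: "longest_dyck_prefix m (Up # C) f"
    using *(4) C longest_dyck_prefix_append_neg[OF neg] by simp
  then obtain b' where b': "Up # C = f @ b'" by (auto simp: longest_dyck_prefix_def prefix_def)
  then have b: "b = b' @ replicate k Down" using *(3) C(2) by (simp flip: append_Cons)
  have l': "longest_dyck_prefix m (Up # C @ s @ replicate k Down) f"
    using l longest_dyck_prefix_append_neg[OF neg, of "s @ replicate k Down" f] by simp
  have "greedy_cover m (a @ s @ replicate k Down) ((A @ f @ Down # b') @ s @ replicate k Down)"
  proof (rule greedy_coverI[OF _ _ _ l'])
    show "dyck m (a @ s @ replicate k Down)" using dyck_insert_dyck[OF s] *(1) by blast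
    show "Up # C @ s @ replicate k Down = f @ b' @ s @ replicate k Down"
      using b' by (metis append_Cons append_assoc)
  qed (simp_all add: C(1))
  moreover have "deep m k (A @ f @ Down # b')"
    unfolding deep_def
  proof (intro allI impI)
    fix p assume p: "strict_prefix p (A @ f @ Down # b') \<and> p \<noteq> []"
    have aa: "a = A @ Down # f @ b'" using C b' by simp
    from p consider "prefix p A" | q where "p = A @ q" "prefix q f"
      | q where "p = A @ f @ Down # q" "strict_prefix q b'"
      unfolding strict_prefix_def prefix_append prefix_Cons by blast
    then show "int k < height m p"
    proof cases
      case 1
      then have "strict_prefix p a" unfolding aa by (auto simp: strict_prefix_def prefix_def)
      then show ?thesis using a p unfolding deep_def by blast
    next
      case 2
      then show ?thesis using f hA by (auto simp: dyck_iff dest: nonnegD)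
    next
      case 3
      then have "strict_prefix (A @ Down # f @ q) a"
        unfolding aa by (auto simp: strict_prefix_def)
      then have "int k < height m (A @ Down # f @ q)" using a unfolding deep_def by blast
      then show ?thesis using 3 by simp
    qed
  qed
  ultimately show thesis using *(5) b by (intro that) auto
qed

lemma greedy_le_outside:
  assumes "greedy_le m (a @ replicate k Down) y" "deep m k a" "dyck m s"
  obtains a' where "y = a' @ replicate k Down"
    "greedy_le m (a @ s @ replicate k Down) (a' @ s @ replicate k Down)"
proof -
  have "\<exists>a'. y = a' @ replicate k Down \<and> deep m k a' \<and>
    greedy_le m (a @ s @ replicate k Down) (a' @ s @ replicate k Down)"
    using assms(1) unfolding greedy_le_def
  proof (induction rule: rtranclp_induct)
    case (step y z)
    then obtain a' where a': "y = a' @ replicate k Down" "deep m k a'"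
      "(greedy_cover m)\<^sup>*\<^sup>* (a @ s @ replicate k Down) (a' @ s @ replicate k Down)" by blast
    with step(2) assms(3) show ?case
      by (blast elim: greedy_cover_outside intro: rtranclp.rtrancl_into_rtrancl)
  qed (use assms in auto)
  then show thesis using that by blast
qed

lemma greedy_le_nonempty:
  assumes "greedy_le m s s'" "s \<noteq> []" "dyck m s"
  shows "s' \<noteq> []"
proof
  assume "s' = []"
  then have "path_size s = 0" using greedy_le_dyck(2)[OF assms(1,3)] by (simp add: path_size_def)
  moreover obtain s0 where "s = Up # s0" using assms dyck_nonempty by blast
  ultimately show False by (simp add: path_size_def)
qed

text \<open>Forwards, each cover changes the host, the inserted path or the height of insertion, and
  the height never decreases. Backwards, the covers are performed in the order host, inserted path,
  shift: while \<open>s\<close> stays at height \<open>k\<close>, the depth of the host lets its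
  covers act undisturbed.\<close>

lemma greedy_le_insertion_iff:
  assumes a: "deep m k a" "dyck m (a @ replicate k Down)" and s: "dyck m s" "s \<noteq> []"
  shows "greedy_le m (a @ s @ replicate k Down) w \<longleftrightarrow>
    (\<exists>a' k' s'. w = a' @ s' @ replicate k' Down \<and> k \<le> k' \<and>
       greedy_le m (a @ replicate k Down) (a' @ replicate k' Down) \<and> greedy_le m s s')"
proof
  assume "greedy_le m (a @ s @ replicate k Down) w"
  then show "\<exists>a' k' s'. w = a' @ s' @ replicate k' Down \<and> k \<le> k' \<and>
       greedy_le m (a @ replicate k Down) (a' @ replicate k' Down) \<and> greedy_le m s s'"
    unfolding greedy_le_def
  proof (induction rule: rtranclp_induct)
    case (step y z)
    then obtain a' k' s' where y: "y = a' @ s' @ replicate k' Down" "k \<le> k'"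
      and r: "(greedy_cover m)\<^sup>*\<^sup>* (a @ replicate k Down) (a' @ replicate k' Down)"
        "(greedy_cover m)\<^sup>*\<^sup>* s s'" by blast
    have d: "dyck m (a' @ replicate k' Down)" "dyck m s'" "s' \<noteq> []"
      using r a s greedy_le_dyck greedy_le_nonempty unfolding greedy_le_def by blast+
    from step(2) y(1) have "greedy_cover m (a' @ s' @ replicate k' Down) z" by simp
    then show ?case using d
    proof (cases rule: greedy_cover_insertion_cases)
      case (inside t)
      then show ?thesis using y r by (metis rtranclp.rtrancl_into_rtrancl)
    next
      case (shift a'')
      then show ?thesis using y r
        by (intro exI[of _ a''] exI[of _ "Suc k'"] exI[of _ s']) simp
    next
      case (outside a'')
      then show ?thesis using y r by (metis rtranclp.rtrancl_into_rtrancl)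
    next
      case (around a'')
      then show ?thesis using y r by (metis rtranclp.rtrancl_into_rtrancl le_SucI)
    qed
  qed blast
next
  assume "\<exists>a' k' s'. w = a' @ s' @ replicate k' Down \<and> k \<le> k' \<and>
       greedy_le m (a @ replicate k Down) (a' @ replicate k' Down) \<and> greedy_le m s s'"
  then obtain a' k' s' where w: "w = a' @ s' @ replicate k' Down" "k \<le> k'"
    and r: "greedy_le m (a @ replicate k Down) (a' @ replicate k' Down)" "greedy_le m s s'" by blast
  have k': "replicate k' Down = replicate (k' - k) Down @ replicate k Down"
    using w(2) by (metis le_add_diff_inverse2 replicate_add)
  obtain a1 where a1: "a' @ replicate k' Down = a1 @ replicate k Down"
    "greedy_le m (a @ s @ replicate k Down) (a1 @ s @ replicate k Down)"
    using greedy_le_outside[OF r(1) a(1) s(1)] by blast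
  \<comment> \<open>Until the final shift only \<open>k\<close> of the \<open>k'\<close> closing
    down steps follow the inserted path; the other \<open>k' - k\<close> end
    \<open>a1\<close>.\<close>
  then have a1': "a1 = a' @ replicate (k' - k) Down" unfolding k' by simp
  have d: "dyck m (a1 @ replicate k Down)" "dyck m s'" "s' \<noteq> []"
    using r a s greedy_le_dyck greedy_le_nonempty a1 by metis+
  have "greedy_le m (a1 @ s @ replicate k Down) (a1 @ s' @ replicate k Down)"
    by (rule greedy_le_in_descent[OF r(2) d(1)])
  moreover have "greedy_le m (a1 @ s' @ replicate k Down) w"
    using greedy_le_shift[OF d(2,3), of a' "k' - k" k] d(1) unfolding a1' w(1) k' by simp
  ultimately show "greedy_le m (a @ s @ replicate k Down) w"
    using a1(2) unfolding greedy_le_def by (meson rtranclp_trans)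
qed

section \<open>The decomposition of paths\<close>

text \<open>With \<open>j\<close> Dyck factors this word ends at height \<open>m - j\<close>;
  completed by \<open>m - j\<close> down steps it is the path \<open>D\<close> with these
  \<open>j\<close> factors and \<open>m + 1 - j\<close> empty ones.\<close>

definition base :: "step list list \<Rightarrow> step list" where
  "base us = Up # concat (map (\<lambda>w. w @ [Down]) us)"

lemma base_snoc: "base (us @ [u]) = base us @ u @ [Down]"
  by (simp add: base_def)

lemma D_path_base: "D_path (us @ s # replicate k []) = base us @ s @ replicate k Down"
proof (cases k)
  case 0
  then show ?thesis by (simp add: D_path_def base_def)
next
  case (Suc j)
  have "us @ s # replicate k [] = (us @ s # replicate j []) @ [[]]"
    by (simp add: Suc replicate_append_same)
  moreover have "concat (map (\<lambda>w. w @ [Down]) (replicate j [])) = replicate j Down"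
    by (induction j) auto
  ultimately show ?thesis
    by (simp only: D_path_def base_def butlast_snoc last_snoc) (simp add: Suc)
qed

lemma D_path_Nil: "D_path (us @ replicate (Suc k) []) = base us @ replicate k Down"
  using D_path_base[of us "[]" k] by simp

lemma height_base:
  assumes "\<forall>u\<in>set us. dyck m u"
  shows "height m (base us) = int m - int (length us)"
  using assms by (induction us rule: rev_induct) (auto simp: base_snoc dyck_height base_def)

text \<open>One induction proves both bounds: the weak one makes the completed word a Dyck path, the
  strict one gives \<open>deep_base\<close>.\<close>

lemma base_prefix_height:
  assumes "\<forall>u\<in>set us. dyck m u"
  shows "prefix p (base us) \<Longrightarrow> p \<noteq> [] \<Longrightarrow> int m - int (length us) \<le> height m p"
    and "strict_prefix p (base us) \<Longrightarrow> p \<noteq> [] \<Longrightarrow> int m - int (length us) < height m p"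
proof -
  have *: "prefix p (base us) \<and> p \<noteq> [] \<longrightarrow>
     int m - int (length us) \<le> height m p \<and> (p \<noteq> base us \<longrightarrow> int m - int (length us) < height m p)" for p
    using assms
  proof (induction us arbitrary: p rule: rev_induct)
    case Nil
    then show ?case by (auto simp: base_def prefix_Cons)
  next
    case (snoc u us)
    have u: "dyck m u" and us: "\<forall>u\<in>set us. dyck m u" using snoc.prems by auto
    show ?case
    proof
      assume p: "prefix p (base (us @ [u])) \<and> p \<noteq> []"
      then consider "prefix p (base us)" | q where "p = base us @ q" "prefix q u" | "p = base (us @ [u])"
        by (auto simp: base_snoc prefix_append prefix_Cons)
      then show "int m - int (length (us @ [u])) \<le> height m p \<and>
        (p \<noteq> base (us @ [u]) \<longrightarrow> int m - int (length (us @ [u])) < height m p)"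
      proof cases
        case 1
        then show ?thesis using snoc.IH[OF us, of p] p by auto
      next
        case 2
        then have "0 \<le> height m q" using u by (auto simp: dyck_iff dest: nonnegD)
        then show ?thesis using 2 height_base[OF us] by simp
      next
        case 3
        then show ?thesis using height_base[OF snoc.prems] by simp
      qed
    qed
  qed
  show "prefix p (base us) \<Longrightarrow> p \<noteq> [] \<Longrightarrow> int m - int (length us) \<le> height m p"
    "strict_prefix p (base us) \<Longrightarrow> p \<noteq> [] \<Longrightarrow> int m - int (length us) < height m p"
    using *[of p] by (auto simp: strict_prefix_def)
qed

lemma deep_base:
  assumes "\<forall>u\<in>set us. dyck m u" "length us \<le> m"
  shows "deep m (m - length us) (base us)"
  using base_prefix_height(2)[OF assms(1)] assms(2) by (auto simp: deep_def of_nat_diff)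

lemma dyck_base:
  assumes "\<forall>u\<in>set us. dyck m u" "length us \<le> m"
  shows "dyck m (base us @ replicate (m - length us) Down)"
proof -
  have "nonneg m (base us)"
    unfolding nonneg_def using base_prefix_height(1)[OF assms(1)] assms(2)
    by (metis diff_ge_0_iff_ge height_simps(1) of_nat_mono order.trans order_refl)
  then show ?thesis
    using height_base[OF assms(1)] assms(2) by (simp add: dyck_iff nonneg_append_Downs of_nat_diff)
qed

text \<open>In either reading the displayed down step is the first step below the axis, so its
  position is determined.\<close>

lemma dyck_Down_inject:
  assumes "a @ Down # b = a' @ Down # b'" "dyck m a" "dyck m a'"
  shows "a = a' \<and> b = b'"
proof -
  have *: "\<not> (\<exists>q. a' = a @ Down # q)" if "dyck m a" "dyck m a'" for a a'
  proof
    assume "\<exists>q. a' = a @ Down # q"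
    then have "prefix (a @ [Down]) a'" by auto
    then have "0 \<le> height m (a @ [Down])" using that by (auto simp: dyck_iff dest: nonnegD)
    then show False using dyck_height[OF that(1)] by simp
  qed
  from assms(1) obtain q where "a = a' @ q \<and> q @ Down # b = Down # b' \<or> a @ q = a' \<and> Down # b = q @ Down # b'"
    unfolding append_eq_append_conv2 by blast
  then show ?thesis
    using *[OF assms(2,3)] *[OF assms(3,2)] by (cases q) auto
qed

lemma concat_Down_inject:
  assumes "length us = length us'" "\<forall>u\<in>set us. dyck m u" "\<forall>u\<in>set us'. dyck m u"
    "concat (map (\<lambda>w. w @ [Down]) us) @ r = concat (map (\<lambda>w. w @ [Down]) us') @ r'"
  shows "us = us' \<and> r = r'"
  using assms
proof (induction us us' rule: list_induct2)
  case (Cons x xs y ys)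
  then have "x @ Down # (concat (map (\<lambda>w. w @ [Down]) xs) @ r) = y @ Down # (concat (map (\<lambda>w. w @ [Down]) ys) @ r')"
    by simp
  with Cons show ?case using dyck_Down_inject[of x _ y _ m] by (metis list.set_intros)
qed simp

lemma base_inject:
  assumes "length us = length us'" "\<forall>u\<in>set us. dyck m u" "\<forall>u\<in>set us'. dyck m u"
    "base us @ s @ replicate k Down = base us' @ s' @ replicate k Down"
  shows "us = us' \<and> s = s'"
  using concat_Down_inject[OF assms(1-3), of "s @ replicate k Down" "s' @ replicate k Down"] assms(4)
  by (simp add: base_def)

text \<open>The first step below the axis lowers the height by only one, so the part before it ends
  exactly at height 0.\<close>

lemma first_passage:
  assumes "height m r < 0"
  obtains p q where "r = p @ Down # q" "dyck m p"
proof -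
  have "\<exists>p q. r = p @ Down # q \<and> dyck m p"
    using assms
  proof (induction r rule: length_induct)
    case (1 r)
    show ?case
    proof (cases "\<exists>p. strict_prefix p r \<and> height m p < 0")
      case True
      then obtain p q where "r = p @ q" "height m p < 0" "length p < length r"
        by (metis prefix_def prefix_length_less strict_prefix_def)
      then show ?thesis using 1(1) by fastforce
    next
      case False
      obtain r' x where r: "r = r' @ [x]" using 1(2) by (cases r rule: rev_cases) auto
      then have "strict_prefix p r" if "prefix p r'" for p
        using that by (auto simp: strict_prefix_def prefix_def)
      then have "nonneg m r'" using False by (auto simp: nonneg_def not_less)
      moreover from this have "x = Down" using 1(2) r nonneg_height[of m r'] by (cases x) auto
      ultimately show ?thesis using 1(2) r nonneg_height[of m r']
        by (intro exI[of _ r'] exI[of _ "[]"]) (auto simp: dyck_iff)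
    qed
  qed
  then show thesis using that by blast
qed

text \<open>Cutting at the first passages to the levels -1, ..., -\<open>j\<close> yields the
  factors; the lower bound makes the remainder a Dyck path.\<close>

lemma concat_Down_exists:
  assumes "height m r = - int j" "\<And>p. prefix p r \<Longrightarrow> - int j \<le> height m p"
  shows "\<exists>us s. length us = j \<and> (\<forall>u\<in>set us. dyck m u) \<and> dyck m s \<and>
           r = concat (map (\<lambda>w. w @ [Down]) us) @ s"
  using assms
proof (induction j arbitrary: r)
  case 0
  then show ?case by (auto simp: dyck_iff nonneg_def)
next
  case (Suc j)
  then obtain p q where r: "r = p @ Down # q" "dyck m p"
    using first_passage[of m r] by (metis neg_less_0_iff_less of_nat_0_less_iff zero_less_Suc)
  have "- int j \<le> height m x" if "prefix x q" for x
    using Suc.prems(2)[of "p @ Down # x"] that r dyck_height[OF r(2)] by simp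
  moreover have "height m q = - int j" using Suc.prems(1) r dyck_height[OF r(2)] by simp
  ultimately obtain us s where "length us = j" "\<forall>u\<in>set us. dyck m u" "dyck m s"
    "q = concat (map (\<lambda>w. w @ [Down]) us) @ s" using Suc.IH[of q] by metis
  then show ?case using r by (intro exI[of _ "p # us"] exI[of _ s]) auto
qed

lemma dyck_base_exists:
  assumes "dyck m v" "v \<noteq> []"
  shows "\<exists>us s. length us = m \<and> (\<forall>u\<in>set us. dyck m u) \<and> dyck m s \<and> v = base us @ s"
proof -
  obtain r where r: "v = Up # r" using assms dyck_nonempty by blast
  have "- int m \<le> height m p" if "prefix p r" for p
    using nonnegD[of m v "Up # p"] that assms(1) r by (simp add: dyck_iff)
  moreover have "height m r = - int m" using dyck_height[OF assms(1)] r by simp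
  ultimately show ?thesis using concat_Down_exists[of m r m] r unfolding base_def by fastforce
qed

section \<open>Sizes, final descents and the sets \<open>J_set m j\<close>\<close>

lemma path_size_simps [simp]:
  "path_size [] = 0"
  "path_size (Up # w) = Suc (path_size w)"
  "path_size (Down # w) = path_size w"
  "path_size (a @ b) = path_size a + path_size b"
  "path_size (replicate k Down) = 0"
  by (simp_all add: path_size_def)

lemma path_size_pos: "dyck m s \<Longrightarrow> s \<noteq> [] \<Longrightarrow> 0 < path_size s"
  by (erule dyck_nonempty) auto

lemma dyck_length: "dyck m w \<Longrightarrow> length w = Suc m * path_size w"
proof -
  have "length w = count_list w Up + count_list w Down" for w
  proof (induction w)
    case (Cons x w)
    then show ?case by (cases x) auto
  qed simp
  then show "dyck m w \<Longrightarrow> length w = Suc m * path_size w"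
    by (simp add: dyck_def path_size_def)
qed

lemma final_descent_append_Downs [simp]:
  "final_descent (w @ replicate k Down) = k + final_descent w"
  by (simp add: final_descent_def takeWhile_append)

lemma final_descent_append: "Up \<in> set s \<Longrightarrow> final_descent (a @ s) = final_descent s"
  by (simp add: final_descent_def)

lemma final_descent_split:
  assumes "k \<le> final_descent w"
  obtains a where "w = a @ replicate k Down"
proof -
  let ?t = "takeWhile (\<lambda>s. s = Down) (rev w)"
  have "take k (rev w) = take k ?t"
    using assms unfolding final_descent_def
    by (metis takeWhile_eq_take take_take min.absorb1)
  also have "\<dots> = replicate k Down"
    using assms unfolding final_descent_def
    by (intro replicate_eqI) (auto dest!: in_set_takeD set_takeWhileD)
  finally have "rev w = replicate k Down @ drop k (rev w)" by (metis append_take_drop_id)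
  then have "w = rev (drop k (rev w)) @ replicate k Down"
    by (metis rev_append rev_replicate rev_rev_ident)
  then show thesis by (rule that)
qed

text \<open>The number \<open>k\<close> of down steps left after the inserted path is its height of
  insertion; the host is always taken to end in at least \<open>k\<close> down steps.\<close>

definition insert_path :: "nat \<Rightarrow> step list \<Rightarrow> step list \<Rightarrow> step list" where
  "insert_path k w s = take (length w - k) w @ s @ replicate k Down"

lemma insert_path_append [simp]: "insert_path k (a @ replicate k Down) s = a @ s @ replicate k Down"
  by (simp add: insert_path_def)

lemma pos_intervals_iff:
  "(v, w) \<in> pos_intervals m \<longleftrightarrow> dyck m v \<and> v \<noteq> [] \<and> greedy_le m v w"
  by (auto simp: pos_intervals_def greedy_intervals_iff path_size_pos)

text \<open>The last factor \<open>s\<close> may be empty; \<open>s = []\<close> gives the pairs of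
  \<open>J_set m j\<close>, so nonempty \<open>s\<close> describes the difference of the two
  sets.\<close>

lemma J_set_Suc:
  assumes "j \<le> m"
  shows "(v, w) \<in> J_set m (Suc j) \<longleftrightarrow> greedy_le m v w \<and>
    (\<exists>us s. length us = j \<and> (\<forall>u\<in>set us. dyck m u) \<and> dyck m s \<and>
       v = base us @ s @ replicate (m - j) Down)"
proof -
  have d: "dyck m (base us @ s @ replicate (m - j) Down)" "base us @ s @ replicate (m - j) Down \<noteq> []"
    if "length us = j" "\<forall>u\<in>set us. dyck m u" "dyck m s" for us s
    using dyck_insert_dyck[OF that(3), of "base us"] dyck_base[OF that(2)] that(1) assms
    by (auto, simp add: base_def)
  have "(\<exists>vs. length vs = Suc j \<and> (\<forall>u\<in>set vs. dyck m u) \<and>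
           v = D_path (vs @ replicate (m + 1 - Suc j) [])) \<longleftrightarrow>
        (\<exists>us s. length us = j \<and> (\<forall>u\<in>set us. dyck m u) \<and> dyck m s \<and>
           v = base us @ s @ replicate (m - j) Down)" (is "?L = ?R")
  proof
    assume ?L
    then obtain vs where vs: "length vs = Suc j" "\<forall>u\<in>set vs. dyck m u"
      "v = D_path (vs @ replicate (m - j) [])" by auto
    then obtain us s where "vs = us @ [s]" by (metis append_butlast_last_id length_0_conv nat.distinct(1))
    then show ?R using vs by (auto simp: D_path_base)
  next
    assume ?R
    then obtain us s where us: "length us = j" "\<forall>u\<in>set us. dyck m u" "dyck m s"
      "v = base us @ s @ replicate (m - j) Down" by blast
    then show ?L by (intro exI[of _ "us @ [s]"]) (auto simp: D_path_base)
  qed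
  then show ?thesis unfolding J_set_def using d by (auto simp: pos_intervals_iff)
qed

lemma J_set_le:
  assumes "j \<le> m"
  shows "(v, w) \<in> J_set m j \<longleftrightarrow> greedy_le m v w \<and>
    (\<exists>us. length us = j \<and> (\<forall>u\<in>set us. dyck m u) \<and> v = base us @ replicate (m - j) Down)"
proof -
  have "m + 1 - j = Suc (m - j)" using assms by simp
  then show ?thesis
    unfolding J_set_def using dyck_base[of _ m] assms
    by (auto simp: pos_intervals_iff D_path_Nil base_def simp del: replicate_Suc)
qed

lemma J_set_subset_pos: "J_set m j \<subseteq> pos_intervals m"
  by (auto simp: J_set_def)

lemma J_set_top: "J_set m (Suc m) = pos_intervals m"
proof (intro equalityI subsetI)
  fix x assume "x \<in> pos_intervals m"
  moreover obtain v w where "x = (v, w)" by fastforce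
  ultimately show "x \<in> J_set m (Suc m)"
    using dyck_base_exists[of m v] by (simp add: J_set_Suc pos_intervals_iff)
qed (use J_set_subset_pos in auto)

lemma J_set_0: "J_set m 0 = {(Up # replicate m Down, Up # replicate m Down)}"
proof -
  have "w = Up # replicate m Down" if "greedy_le m (Up # replicate m Down) w" for w
    using that unfolding greedy_le_def
  proof (induction rule: rtranclp_induct)
    case (step y z)
    then obtain a c where "Up # replicate m Down = a @ Down # Up # c"
      by (metis greedy_coverE)
    then have "Up \<in> set (replicate m Down)" by (cases a) auto
    then show ?case by (auto split: if_splits)
  qed simp
  then show ?thesis by (auto simp: J_set_le base_def greedy_le_def)
qed

lemma J_set_mono:
  assumes "j \<le> m"
  shows "J_set m j \<subseteq> J_set m (Suc j)"
proof clarify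
  fix v w assume "(v, w) \<in> J_set m j"
  then obtain us where "greedy_le m v w" "length us = j" "\<forall>u\<in>set us. dyck m u"
    "v = base us @ [] @ replicate (m - j) Down" using assms by (auto simp: J_set_le)
  then show "(v, w) \<in> J_set m (Suc j)"
    unfolding J_set_Suc[OF assms] using dyck_Nil[of m] by blast
qed

text \<open>The \<open>m - j\<close> closing down steps of \<open>v\<close> lie below all its
  valleys, and every greedy cover preserves them.\<close>

lemma J_set_final_descent:
  assumes "(v, w) \<in> J_set m j" "j \<le> m"
  shows "m - j \<le> final_descent w"
proof -
  obtain us where us: "greedy_le m v w" "length us = j" "\<forall>u\<in>set us. dyck m u"
    "v = base us @ replicate (m - j) Down" using assms by (auto simp: J_set_le)
  have "deep m (m - j) (base us)" using deep_base us assms(2) by blast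
  then obtain a where "w = a @ replicate (m - j) Down"
    using greedy_le_outside[of m "base us" "m - j" w "[]"] us by auto
  then show ?thesis by simp
qed

section \<open>The bijection between insertions and the new intervals\<close>

lemma insertion_inject:
  assumes "a @ s @ replicate k Down = b @ r @ replicate l Down"
    and "dyck m s" "dyck m r" "path_size s = path_size r" "s \<noteq> []"
  shows "a = b \<and> s = r \<and> k = l"
proof -
  have *: "length b \<le> length a"
    if eq: "a @ s @ replicate k Down = b @ r @ replicate l Down" and s: "s = Up # s0"
      and sz: "path_size s = path_size r" for a b s r :: "step list" and k l s0
  proof (rule ccontr)
    assume "\<not> length b \<le> length a"
    then obtain q where q: "b = a @ q" "s @ replicate k Down = q @ r @ replicate l Down"
      using eq unfolding append_eq_append_conv2[of a] by auto
    then have "q \<noteq> []" using \<open>\<not> length b \<le> length a\<close> by auto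
    then obtain q' where "q = Up # q'" using s q by (cases q) auto
    then have "path_size (s @ replicate k Down) = Suc (path_size q') + path_size r" using q(2) by simp
    then show False using sz by simp
  qed
  have "r \<noteq> []" using path_size_pos[OF assms(2,5)] assms(4) by auto
  with assms(2,3,5) obtain s0 r0 where sr: "s = Up # s0" "r = Up # r0" by (metis dyck_nonempty)
  have "length a = length b"
    using *[OF assms(1) sr(1) assms(4)] *[OF assms(1)[symmetric] sr(2) assms(4)[symmetric]] by simp
  moreover have "length s = length r" using dyck_length assms(2-4) by metis
  ultimately show ?thesis using assms(1) by (metis append_eq_append_conv length_replicate)
qed

text \<open>An element consists of a host interval, the interval to be inserted, and the height of
  insertion in the upper host; in the lower host that height is always \<open>m - j\<close>.\<close>

definition insertions ::
  "nat \<Rightarrow> nat \<Rightarrow> (((step list \<times> step list) \<times> (step list \<times> step list)) \<times> nat) set" where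
  "insertions m j =
     (SIGMA p : J_set m j \<times> pos_intervals m. {m - j..final_descent (snd (fst p))})"

definition insert_interval ::
  "nat \<Rightarrow> nat \<Rightarrow> ((step list \<times> step list) \<times> (step list \<times> step list)) \<times> nat \<Rightarrow> step list \<times> step list" where
  "insert_interval m j = (\<lambda>(((v, w), (s, s')), k). (insert_path (m - j) v s, insert_path k w s'))"

lemma insertionsE:
  assumes "q \<in> insertions m j" "j \<le> m"
  obtains us s a s' k where
    "q = (((base us @ replicate (m - j) Down, a @ replicate k Down), (s, s')), k)"
    "length us = j" "\<forall>u\<in>set us. dyck m u" "dyck m s" "s \<noteq> []" "m - j \<le> k"
    "greedy_le m (base us @ replicate (m - j) Down) (a @ replicate k Down)" "greedy_le m s s'"
    "dyck m s'" "s' \<noteq> []" "path_size s' = path_size s"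
    "insert_interval m j q = (base us @ s @ replicate (m - j) Down, a @ s' @ replicate k Down)"
proof -
  obtain v w s s' k where q: "q = (((v, w), (s, s')), k)" by (metis surj_pair)
  have vw: "(v, w) \<in> J_set m j" and ss: "(s, s') \<in> pos_intervals m"
    and k: "m - j \<le> k" "k \<le> final_descent w"
    using assms(1) by (auto simp: insertions_def q)
  obtain us where us: "greedy_le m v w" "length us = j" "\<forall>u\<in>set us. dyck m u"
    "v = base us @ replicate (m - j) Down" using vw assms(2) by (auto simp: J_set_le)
  obtain a where a: "w = a @ replicate k Down" using k(2) by (rule final_descent_split)
  show thesis
    using q us a k ss greedy_le_dyck[of m s s'] greedy_le_nonempty[of m s s']
    by (intro that[of us a k s s']) (auto simp: insert_interval_def pos_intervals_iff)
qed

lemma insertionsI: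
  assumes "j \<le> m" "length us = j" "\<forall>u\<in>set us. dyck m u" "dyck m s" "s \<noteq> []" "m - j \<le> k"
    "greedy_le m (base us @ replicate (m - j) Down) (a @ replicate k Down)" "greedy_le m s s'"
  shows "(((base us @ replicate (m - j) Down, a @ replicate k Down), (s, s')), k) \<in> insertions m j"
  using assms by (auto simp: insertions_def J_set_le pos_intervals_iff)

text \<open>The lower path determines \<open>s\<close>, hence the size of \<open>s'\<close>. Given
  that size, the upper path determines \<open>s'\<close> and its position: were one of two
  candidates to begin earlier, it would contain all up steps of the other and at least one more.
  Surjectivity is the description of the elements above an insertion.\<close>

lemma bij_insert_interval:
  assumes j: "j \<le> m"
  shows "bij_betw (insert_interval m j) (insertions m j) (J_set m (Suc j) - J_set m j)"
  unfolding bij_betw_def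
proof
  show "inj_on (insert_interval m j) (insertions m j)"
  proof (rule inj_onI)
    fix p q assume p: "p \<in> insertions m j" and q: "q \<in> insertions m j"
      and eq: "insert_interval m j p = insert_interval m j q"
    from p j obtain us s a s' k where P:
      "p = (((base us @ replicate (m - j) Down, a @ replicate k Down), (s, s')), k)"
      "length us = j" "\<forall>u\<in>set us. dyck m u" "dyck m s" "s \<noteq> []" "m - j \<le> k"
      "greedy_le m (base us @ replicate (m - j) Down) (a @ replicate k Down)" "greedy_le m s s'"
      "dyck m s'" "s' \<noteq> []" "path_size s' = path_size s"
      "insert_interval m j p = (base us @ s @ replicate (m - j) Down, a @ s' @ replicate k Down)"
      by (rule insertionsE)
    from q j obtain vs r b r' l where Q:
      "q = (((base vs @ replicate (m - j) Down, b @ replicate l Down), (r, r')), l)"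
      "length vs = j" "\<forall>u\<in>set vs. dyck m u" "dyck m r" "r \<noteq> []" "m - j \<le> l"
      "greedy_le m (base vs @ replicate (m - j) Down) (b @ replicate l Down)" "greedy_le m r r'"
      "dyck m r'" "r' \<noteq> []" "path_size r' = path_size r"
      "insert_interval m j q = (base vs @ r @ replicate (m - j) Down, b @ r' @ replicate l Down)"
      by (rule insertionsE)
    have "us = vs \<and> s = r"
      using eq P(2,3,12) Q(2,3,12) by (intro base_inject[of us vs m s "m - j" r]) auto
    moreover from this have "a = b \<and> s' = r' \<and> k = l"
      using eq P(9-12) Q(9-12) by (intro insertion_inject[of a s' k b r' l m]) auto
    ultimately show "p = q" using P(1) Q(1) by simp
  qed
  show "insert_interval m j ` insertions m j = J_set m (Suc j) - J_set m j"
  proof (intro equalityI subsetI)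
    fix y assume "y \<in> insert_interval m j ` insertions m j"
    then obtain q where q: "q \<in> insertions m j" "y = insert_interval m j q" by blast
    from q(1) j obtain us s a s' k where P:
      "q = (((base us @ replicate (m - j) Down, a @ replicate k Down), (s, s')), k)"
      "length us = j" "\<forall>u\<in>set us. dyck m u" "dyck m s" "s \<noteq> []" "m - j \<le> k"
      "greedy_le m (base us @ replicate (m - j) Down) (a @ replicate k Down)" "greedy_le m s s'"
      "dyck m s'" "s' \<noteq> []" "path_size s' = path_size s"
      "insert_interval m j q = (base us @ s @ replicate (m - j) Down, a @ s' @ replicate k Down)"
      by (rule insertionsE)
    have "greedy_le m (base us @ s @ replicate (m - j) Down) (a @ s' @ replicate k Down)"
      using greedy_le_insertion_iff[OF _ _ P(4,5), of "m - j" "base us"]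
        deep_base[OF P(3)] dyck_base[OF P(3)] P(2,6,7,8) j by blast
    then have "y \<in> J_set m (Suc j)"
      using P j unfolding q(2) P(12) J_set_Suc[OF j] by blast
    moreover have "y \<notin> J_set m j"
    proof
      assume "y \<in> J_set m j"
      then obtain vs where "length vs = j" "\<forall>u\<in>set vs. dyck m u"
        "base us @ s @ replicate (m - j) Down = base vs @ [] @ replicate (m - j) Down"
        unfolding q(2) P(12) J_set_le[OF j] by auto
      then show False using base_inject[of us vs m s "m - j" "[]"] P by auto
    qed
    ultimately show "y \<in> J_set m (Suc j) - J_set m j" by blast
  next
    fix y assume y: "y \<in> J_set m (Suc j) - J_set m j"
    obtain v w where vw: "y = (v, w)" by fastforce
    obtain us s where us: "greedy_le m v w" "length us = j" "\<forall>u\<in>set us. dyck m u" "dyck m s"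
       "v = base us @ s @ replicate (m - j) Down"
      using y j by (auto simp: vw J_set_Suc)
    have "s \<noteq> []" using us y j by (auto simp: vw J_set_le)
    then obtain a k s' where w: "w = a @ s' @ replicate k Down" "m - j \<le> k"
       "greedy_le m (base us @ replicate (m - j) Down) (a @ replicate k Down)" "greedy_le m s s'"
      using greedy_le_insertion_iff[OF _ _ us(4), of "m - j" "base us" w]
        deep_base[OF us(3)] dyck_base[OF us(3)] us(1,2,5) j by blast
    let ?q = "(((base us @ replicate (m - j) Down, a @ replicate k Down), (s, s')), k)"
    have "?q \<in> insertions m j"
      using insertionsI[OF j us(2-4) \<open>s \<noteq> []\<close> w(2-4)] .
    moreover have "insert_interval m j ?q = y"
      by (simp add: insert_interval_def vw us w)
    ultimately show "y \<in> insert_interval m j ` insertions m j" by force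
  qed
qed

lemma insert_interval_size:
  assumes "(((v, w), (s, s')), k) \<in> insertions m j" "j \<le> m"
  shows "path_size (fst (insert_interval m j (((v, w), (s, s')), k))) = path_size v + path_size s"
    and "final_descent (snd (insert_interval m j (((v, w), (s, s')), k))) = k + final_descent s'"
proof -
  from assms obtain us a where P:
      "v = base us @ replicate (m - j) Down" "w = a @ replicate k Down" "dyck m s'" "s' \<noteq> []"
    by (auto elim!: insertionsE)
  then have "Up \<in> set s'" by (auto elim: dyck_nonempty)
  then show "path_size (fst (insert_interval m j (((v, w), (s, s')), k))) = path_size v + path_size s"
    "final_descent (snd (insert_interval m j (((v, w), (s, s')), k))) = k + final_descent s'"
    using P final_descent_append_Downs[of "a @ s'" k]
    by (simp_all add: insert_interval_def final_descent_append)
qed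

section \<open>The functional equations\<close>

definition lift :: "rat fps \<Rightarrow> rat poly fps" where
  "lift F = Abs_fps (\<lambda>n. [:fps_nth F n:])"

abbreviation x_series :: "rat poly fps" where
  "x_series \<equiv> fps_const [:0, 1:]"

lemma finite_pos_intervals_size:
  assumes "S \<subseteq> pos_intervals m"
  shows "finite {(v, w) \<in> S. path_size v = n}"
proof -
  let ?W = "{w. set w \<subseteq> {Up, Down} \<and> length w = Suc m * n}"
  have UNIV: "set w \<subseteq> {Up, Down}" for w using step.exhaust by blast
  have "{(v, w) \<in> S. path_size v = n} \<subseteq> ?W \<times> ?W"
  proof
    fix p assume p: "p \<in> {(v, w) \<in> S. path_size v = n}"
    then obtain v w where vw: "p = (v, w)" "(v, w) \<in> S" "path_size v = n" by auto
    then have "dyck m v" "greedy_le m v w" using assms by (auto simp: pos_intervals_iff)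
    then show "p \<in> ?W \<times> ?W"
      using greedy_le_dyck[of m v w] dyck_length[of m v] dyck_length[of m w] UNIV vw by auto
  qed
  moreover have "finite (?W \<times> ?W)" by (intro finite_cartesian_product finite_lists_length_eq) auto
  ultimately show ?thesis by (rule finite_subset)
qed

lemma gf_nth:
  "fps_nth (gf S) n = (\<Sum>p\<in>{p\<in>S. path_size (fst p) = n}. monom 1 (final_descent (snd p)))"
  unfolding gf_def by (simp add: case_prod_beta')

lemma finite_size:
  assumes "S \<subseteq> pos_intervals m"
  shows "finite {p \<in> S. path_size (fst p) = n}"
  using finite_pos_intervals_size[OF assms, of n] by (simp add: case_prod_beta')

text \<open>Host intervals with a marked height of insertion \<open>k\<close>, weighted by
  \<open>x^k\<close>; this is the divided difference of the functional equation before
  summation.\<close>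

definition insertion_gf :: "nat \<Rightarrow> nat \<Rightarrow> rat poly fps" where
  "insertion_gf m j = Abs_fps (\<lambda>n. \<Sum>p\<in>{p\<in>J_set m j. path_size (fst p) = n}.
     \<Sum>k=m-j..final_descent (snd p). monom 1 k)"

text \<open>Sizes add under insertion and the final descent becomes \<open>k\<close> plus that of
  the inserted path, so the weight factors; sorting by the size of the host gives the Cauchy
  product.\<close>

lemma gf_insertions:
  assumes j: "j \<le> m"
  shows "gf (J_set m (Suc j) - J_set m j) = insertion_gf m j * I_gf m"
proof (rule fps_ext)
  fix n
  define A where "A i = {p \<in> J_set m j. path_size (fst p) = i}" for i
  define B where "B i = {p \<in> pos_intervals m. path_size (fst p) = i}" for i
  have fin: "finite (A i)" "finite (B i)" for i
    unfolding A_def B_def using J_set_subset_pos by (auto intro!: finite_size)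
  define f where "f q = monom (1::rat) (snd q) * monom 1 (final_descent (snd (snd (fst q))))"
    for q :: "((step list \<times> step list) \<times> (step list \<times> step list)) \<times> nat"
  define sz where "sz q = path_size (fst (fst (fst q)))"
    for q :: "((step list \<times> step list) \<times> (step list \<times> step list)) \<times> nat"
  define Q where "Q = {q \<in> insertions m j. sz q + path_size (fst (snd (fst q))) = n}"
  have Qi: "{q \<in> Q. sz q = i} = (SIGMA p : A i \<times> B (n - i). {m - j..final_descent (snd (fst p))})"
    if "i \<le> n" for i
    using that by (auto simp: Q_def insertions_def sz_def A_def B_def)
  have "finite Q"
  proof (rule finite_subset)
    show "Q \<subseteq> (\<Union>i\<in>{..n}. {q \<in> Q. sz q = i})" by (auto simp: Q_def)
    show "finite (\<Union>i\<in>{..n}. {q \<in> Q. sz q = i})" using fin by (auto simp: Qi)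
  qed
  have "bij_betw (insert_interval m j) Q {p \<in> J_set m (Suc j) - J_set m j. path_size (fst p) = n}"
  proof (rule bij_betw_imageI)
    show "inj_on (insert_interval m j) Q"
      using bij_betw_imp_inj_on[OF bij_insert_interval[OF j]] by (rule inj_on_subset) (auto simp: Q_def)
    have "path_size (fst (insert_interval m j q)) = sz q + path_size (fst (snd (fst q)))"
      if "q \<in> insertions m j" for q
      using that insert_interval_size(1)[OF _ j] by (cases q) (auto simp: sz_def)
    then show "insert_interval m j ` Q = {p \<in> J_set m (Suc j) - J_set m j. path_size (fst p) = n}"
      unfolding bij_betw_imp_surj_on[OF bij_insert_interval[OF j], symmetric] Q_def by force
  qed
  then have "fps_nth (gf (J_set m (Suc j) - J_set m j)) n =
      (\<Sum>q\<in>Q. monom 1 (final_descent (snd (insert_interval m j q))))"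
    unfolding gf_nth by (rule sum.reindex_bij_betw[symmetric])
  also have "\<dots> = (\<Sum>q\<in>Q. f q)"
    using insert_interval_size(2)[OF _ j]
    by (intro sum.cong) (auto simp: Q_def f_def mult_monom)
  also have "\<dots> = (\<Sum>i\<le>n. \<Sum>q\<in>{q \<in> Q. sz q = i}. f q)"
    using \<open>finite Q\<close> by (intro sum.group[symmetric]) (auto simp: Q_def)
  also have "\<dots> = (\<Sum>i\<le>n. fps_nth (insertion_gf m j) i * fps_nth (I_gf m) (n - i))"
  proof (intro sum.cong refl)
    fix i assume "i \<in> {..n}"
    then have "(\<Sum>q\<in>{q \<in> Q. sz q = i}. f q) =
        (\<Sum>p\<in>A i \<times> B (n - i). \<Sum>k=m-j..final_descent (snd (fst p)). f (p, k))"
      using fin by (simp add: Qi sum.Sigma)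
    also have "\<dots> = (\<Sum>p\<in>A i. \<Sum>s\<in>B (n - i). \<Sum>k=m-j..final_descent (snd p). f ((p, s), k))"
      using sum.cartesian_product[of "\<lambda>p s. \<Sum>k=m-j..final_descent (snd p). f ((p, s), k)" "B (n - i)" "A i"]
      by (simp add: case_prod_beta')
    also have "\<dots> = (\<Sum>p\<in>A i. \<Sum>k=m-j..final_descent (snd p). monom 1 k) *
        (\<Sum>s\<in>B (n - i). monom 1 (final_descent (snd s)))"
      unfolding sum_product by (simp add: f_def sum_distrib_right)
    finally show "(\<Sum>q\<in>{q \<in> Q. sz q = i}. f q) =
        fps_nth (insertion_gf m j) i * fps_nth (I_gf m) (n - i)"
      by (simp add: insertion_gf_def I_gf_def gf_nth A_def B_def)
  qed
  also have "\<dots> = fps_nth (insertion_gf m j * I_gf m) n"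
    by (simp add: fps_mult_nth atLeast0AtMost)
  finally show "fps_nth (gf (J_set m (Suc j) - J_set m j)) n = fps_nth (insertion_gf m j * I_gf m) n" .
qed

lemma geometric_monom:
  assumes "a \<le> Suc b"
  shows "[:-1, 1::rat:] * (\<Sum>k=a..b. monom 1 k) = monom 1 (Suc b) - monom 1 a"
  using assms
proof (induction b)
  case (Suc b)
  show ?case
  proof (cases "a = Suc (Suc b)")
    case False
    then have "[:-1, 1::rat:] * (\<Sum>k=a..Suc b. monom 1 k) =
      [:-1, 1:] * (\<Sum>k=a..b. monom 1 k) + [:-1, 1:] * monom 1 (Suc b)"
      using Suc.prems by (simp add: distrib_left)
    also have "[:-1, 1::rat:] * monom 1 (Suc b) = monom 1 (Suc (Suc b)) - monom 1 (Suc b)"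
      by (simp add: monom_Suc)
    finally show ?thesis using Suc False by simp
  qed simp
qed (cases a; auto simp: monom_Suc one_pCons)

text \<open>For a host of final descent \<open>d\<close>, the geometric sum times
  \<open>x - 1\<close> is \<open>x^(d+1) - x^(m-j)\<close>. The first power contributes to
  \<open>x J\<close>, and the second, being the same for all hosts, to
  \<open>x^(m-j) J(1)\<close>.\<close>

lemma insertion_gf_eq:
  assumes "j \<le> m"
  shows "(x_series - 1) * insertion_gf m j =
    x_series * J_gf m j - x_series ^ (m - j) * lift (at_x1 (J_gf m j))"
proof (rule fps_ext)
  fix n
  let ?A = "{p \<in> J_set m j. path_size (fst p) = n}"
  have x1: "x_series - 1 = fps_const [:-1, 1:]"
    by (simp flip: fps_const_1_eq_1 add: fps_const_sub one_pCons)
  have xp: "x_series ^ k = fps_const (monom 1 k)" for k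
    by (simp add: fps_const_power monom_altdef)
  have "fps_nth (lift (at_x1 (J_gf m j))) n = (\<Sum>p\<in>?A. 1)"
    by (simp add: lift_def at_x1_def J_gf_def gf_nth poly_sum poly_monom of_nat_poly)
  moreover have "fps_nth ((x_series - 1) * insertion_gf m j) n =
      (\<Sum>p\<in>?A. [:-1, 1:] * (\<Sum>k=m-j..final_descent (snd p). monom 1 k))"
    by (simp add: x1 insertion_gf_def sum_distrib_left del: mult_pCons_left)
  moreover have "\<dots> = (\<Sum>p\<in>?A. monom 1 1 * monom 1 (final_descent (snd p)) - monom 1 (m - j) * 1)"
  proof (intro sum.cong refl)
    fix p assume p: "p \<in> ?A"
    then have "m - j \<le> final_descent (snd p)"
      using J_set_final_descent[OF _ assms, of "fst p" "snd p"] by simp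
    then show "[:-1, 1:] * (\<Sum>k=m-j..final_descent (snd p). monom 1 k) =
        monom (1::rat) 1 * monom 1 (final_descent (snd p)) - monom 1 (m - j) * 1"
      by (subst geometric_monom) (auto simp: mult_monom)
  qed
  moreover have "[:0, 1::rat:] = monom 1 1" by (simp add: monom_altdef)
  ultimately show "fps_nth ((x_series - 1) * insertion_gf m j) n =
      fps_nth (x_series * J_gf m j - x_series ^ (m - j) * lift (at_x1 (J_gf m j))) n"
    by (simp add: xp monom_power J_gf_def gf_nth sum_subtractf sum_distrib_left del: sum_constant)
qed

lemma J_gf_Suc:
  assumes "j \<le> m"
  shows "(x_series - 1) * J_gf m (Suc j) = (x_series - 1) * J_gf m j +
    I_gf m * (x_series * J_gf m j - x_series ^ (m - j) * lift (at_x1 (J_gf m j)))"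
proof -
  have "gf (J_set m (Suc j)) = gf (J_set m j) + gf (J_set m (Suc j) - J_set m j)"
  proof (rule fps_ext)
    fix n
    have "{p \<in> J_set m (Suc j). path_size (fst p) = n} = {p \<in> J_set m j. path_size (fst p) = n} \<union>
        {p \<in> J_set m (Suc j) - J_set m j. path_size (fst p) = n}"
      using J_set_mono[OF assms] by auto
    moreover have "finite {p \<in> J_set m (Suc j). path_size (fst p) = n}"
      by (rule finite_size[OF J_set_subset_pos])
    ultimately show "fps_nth (gf (J_set m (Suc j))) n =
        fps_nth (gf (J_set m j) + gf (J_set m (Suc j) - J_set m j)) n"
      by (simp add: gf_nth) (subst sum.union_disjoint, auto)
  qed
  then have "J_gf m (Suc j) = J_gf m j + insertion_gf m j * I_gf m"
    by (simp add: J_gf_def gf_insertions[OF assms])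
  then have "(x_series - 1) * J_gf m (Suc j) =
      (x_series - 1) * J_gf m j + I_gf m * ((x_series - 1) * insertion_gf m j)"
    by (simp add: algebra_simps)
  then show ?thesis by (simp only: insertion_gf_eq[OF assms])
qed

lemma J_gf_top: "J_gf m (Suc m) = I_gf m"
  by (simp add: J_gf_def I_gf_def J_set_top)

lemma J_gf_0: "J_gf m 0 = fps_X * x_series ^ m"
proof (rule fps_ext)
  fix n
  have "{p \<in> J_set m 0. path_size (fst p) = n} =
      (if n = 1 then {(Up # replicate m Down, Up # replicate m Down)} else {})"
    by (auto simp: J_set_0)
  moreover have "final_descent (Up # replicate m Down) = m"
    using final_descent_append_Downs[of "[Up]" m] by (simp add: final_descent_def)
  ultimately show "fps_nth (J_gf m 0) n = fps_nth (fps_X * x_series ^ m) n"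
    by (simp add: J_gf_def gf_nth fps_const_power monom_altdef fps_X_def)
qed

section \<open>The recurrence for the polynomials H\<close>

text \<open>
  The coefficient of \<open>(- z)\<^sup>k u\<^sup>j\<close> in \<open>H\<^sub>i / u\<^sup>i\<^sup>+\<^sup>1\<close>. For \<open>i = m + 1\<close> and \<open>k = 1\<close> the truncated subtraction
  makes the first binomial coefficient of the last line equal to 1; with this value the formula for
  \<open>i \<le> m\<close> also covers \<open>H\<^sub>m\<^sub>+\<^sub>1\<close>.
\<close>

definition Hcoeff :: "nat \<Rightarrow> nat \<Rightarrow> nat \<Rightarrow> nat \<Rightarrow> nat" where
  "Hcoeff m i k j =
     (if k = 0 then of_bool (j = 0)
      else if i + j \<le> m then (Suc i choose k) * (j + k - 1 choose j)
      else (m + k - i - 1 choose (k - 1)) * (Suc m - j choose k))"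

text \<open>The coefficient at \<open>j = m + 1\<close> is 0; including it supplies the boundary
  condition of the telescoping sums.\<close>

definition Hslice :: "nat \<Rightarrow> nat \<Rightarrow> nat \<Rightarrow> 'a::comm_ring_1 \<Rightarrow> 'a" where
  "Hslice m i k u = (\<Sum>j\<le>Suc m. of_nat (Hcoeff m i k j) * u ^ j)"

definition Hsum :: "nat \<Rightarrow> nat \<Rightarrow> 'a::comm_ring_1 \<Rightarrow> 'a \<Rightarrow> 'a" where
  "Hsum m i z u = (\<Sum>k\<le>m + 2. (- z) ^ k * Hslice m i k u)"

lemma sum_telescope_power:
  fixes D :: "nat \<Rightarrow> 'a::comm_ring_1"
  assumes "e 0 = - D 0" "\<And>j. e (Suc j) = D j - D (Suc j)"
  shows "(u - 1) * (\<Sum>j\<le>N. D j * u ^ j) = (\<Sum>j\<le>N. e j * u ^ j) + D N * u ^ Suc N"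
  by (induction N) (simp_all add: assms algebra_simps)

text \<open>The relation for the exceptional index \<open>q\<close> is recovered by evaluating at \<open>u = 1\<close>.\<close>

lemma sum_telescope_except_one:
  fixes D a :: "nat \<Rightarrow> 'a::comm_ring_1"
  assumes "D N = 0" "q \<le> N"
    and "q \<noteq> 0 \<Longrightarrow> D 0 = a 0"
    and "\<And>j. j < N \<Longrightarrow> Suc j \<noteq> q \<Longrightarrow> D (Suc j) - D j = a (Suc j)"
  shows "(u - 1) * (\<Sum>j\<le>N. D j * u ^ j) = - ((\<Sum>j\<le>N. a j * u ^ j) - u ^ q * (\<Sum>j\<le>N. a j))"
proof -
  \<comment> \<open>These are the coefficients of \<open>u - 1\<close> times the polynomial with
    coefficients \<open>D\<close>; no term beyond degree \<open>N\<close> arises because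
    \<open>D N = 0\<close>.\<close>
  define e where "e j = (case j of 0 \<Rightarrow> - D 0 | Suc j' \<Rightarrow> D j' - D j)" for j
  have tel: "(v - 1) * (\<Sum>j\<le>N. D j * v ^ j) = (\<Sum>j\<le>N. e j * v ^ j)" for v
    using sum_telescope_power[of e D v N] assms(1) by (simp add: e_def)
  have e: "e j = - a j" if "j \<le> N" "j \<noteq> q" for j
    using that assms(3) assms(4)[of "j - 1"] by (cases j) (auto simp: e_def algebra_simps)
  have *: "(\<Sum>j\<le>N. (e j + a j) * v ^ j) = (e q + a q) * v ^ q" for v
  proof -
    have "(\<Sum>j\<le>N. (e j + a j) * v ^ j) = (\<Sum>j\<in>{q}. (e j + a j) * v ^ j)"
      using e assms(2) by (intro sum.mono_neutral_right) auto
    then show ?thesis by simp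
  qed
  have "e q + a q = (\<Sum>j\<le>N. a j)"
    using *[of 1] tel[of 1] by (simp add: sum.distrib)
  then show ?thesis
    using *[of u] tel[of u] by (simp add: sum.distrib distrib_right algebra_simps)
qed

lemma Hcoeff_low:
  assumes "i + j < m"
  shows "Hcoeff m (Suc i) (Suc k) j = Hcoeff m i (Suc k) j + (Suc i choose k) * (j + k choose j)"
  using assms by (simp add: Hcoeff_def algebra_simps)

text \<open>For \<open>i + j = m\<close> the two formulas in \<open>Hcoeff\<close> coincide, so the
  second may be used there too; the rest is Pascal's rule in the first binomial coefficient.\<close>

lemma Hcoeff_high:
  assumes "i \<le> m" "m \<le> i + j" "j \<le> Suc m"
  shows "Hcoeff m i (Suc k) j = Hcoeff m (Suc i) (Suc k) j +
    (if k = 0 then 0 else (m + k - i - 1 choose (k - 1)) * (Suc m - j choose Suc k))"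
proof -
  have 1: "Hcoeff m i (Suc k) j = (m + k - i choose k) * (Suc m - j choose Suc k)"
  proof (cases "i + j = m")
    case True
    then have "j + k = m + k - i" "Suc m - j = Suc i" by auto
    moreover have "j + k choose j = j + k choose k" using binomial_symmetric[of j "j + k"] by simp
    ultimately show ?thesis using True by (simp add: Hcoeff_def)
  next
    case False
    then show ?thesis using assms by (simp add: Hcoeff_def)
  qed
  show ?thesis
  proof (cases k)
    case 0
    then show ?thesis using 1 assms by (simp add: Hcoeff_def)
  next
    case (Suc k')
    then have "m + k - i = Suc (m + k' - i)" using assms by simp
    then show ?thesis using 1 assms Suc by (simp add: Hcoeff_def algebra_simps)
  qed
qed

text \<open>Below and from \<open>j = m - i\<close> on, the coefficients of the difference follow
  one formula each, and Pascal's rule gives their successive differences. The change of formula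
  makes \<open>m - i\<close> the exceptional index.\<close>

lemma Hslice_Suc:
  fixes u :: "'a::comm_ring_1"
  assumes i: "i \<le> m"
  shows "(u - 1) * (Hslice m (Suc i) (Suc k) u - Hslice m i (Suc k) u) =
    - (Hslice m i k u - u ^ (m - i) * Hslice m i k 1)"
proof -
  define D :: "nat \<Rightarrow> 'a" where
    "D j = of_nat (Hcoeff m (Suc i) (Suc k) j) - of_nat (Hcoeff m i (Suc k) j)" for j
  define B where "B = (if k = 0 then 0 else m + k - i - 1 choose (k - 1))"
  have low: "D j = of_nat ((Suc i choose k) * (j + k choose j))" if "i + j < m" for j
    unfolding D_def Hcoeff_low[OF that] by simp
  have high: "D j = - of_nat (B * (Suc m - j choose Suc k))" if "m \<le> i + j" "j \<le> Suc m" for j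
    unfolding D_def Hcoeff_high[OF i that] B_def by simp
  have "(u - 1) * (\<Sum>j\<le>Suc m. D j * u ^ j) =
    - ((\<Sum>j\<le>Suc m. of_nat (Hcoeff m i k j) * u ^ j) - u ^ (m - i) * (\<Sum>j\<le>Suc m. of_nat (Hcoeff m i k j)))"
  proof (rule sum_telescope_except_one)
    show "D (Suc m) = 0" using high[of "Suc m"] i by simp
    show "D 0 = of_nat (Hcoeff m i k 0)" if "m - i \<noteq> 0"
      using that by (subst low) (auto simp: Hcoeff_def)
    show "D (Suc j) - D j = of_nat (Hcoeff m i k (Suc j))" if "j < Suc m" "Suc j \<noteq> m - i" for j
    proof (cases "i + j < m")
      case True
      then have "i + Suc j < m" using that by auto
      then show ?thesis
        using True by (simp only: low) (auto simp: Hcoeff_def binomial_eq_0 algebra_simps)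
    next
      case False
      then have h: "m \<le> i + j" "m \<le> i + Suc j" "j \<le> Suc m" "Suc j \<le> Suc m" using that by auto
      have "Suc m - j = Suc (Suc m - Suc j)" using that by simp
      then have "Suc m - j choose Suc k = (Suc m - Suc j choose k) + (Suc m - Suc j choose Suc k)"
        by (simp only: binomial_Suc_Suc)
      then have "D (Suc j) - D j = of_nat (B * (Suc m - Suc j choose k))"
        unfolding high[OF h(1,3)] high[OF h(2,4)] by (simp add: algebra_simps)
      also have "B * (Suc m - Suc j choose k) = Hcoeff m i k (Suc j)"
        using h by (auto simp: B_def Hcoeff_def)
      finally show ?thesis .
    qed
  qed auto
  then show ?thesis
    by (simp only: Hslice_def D_def left_diff_distrib sum_subtractf power_one mult_1_right)
qed

lemma Hslice_0: "Hslice m i 0 u = 1"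
proof -
  have "Hslice m i 0 u = (\<Sum>j\<le>Suc m. if j = 0 then 1 else 0)"
    unfolding Hslice_def by (intro sum.cong) (auto simp: Hcoeff_def)
  then show ?thesis by simp
qed

lemma Hsum_Suc:
  assumes i: "i \<le> m"
  shows "(u - 1) * (Hsum m (Suc i) z u - Hsum m i z u) =
    z * (Hsum m i z u - u ^ (m - i) * Hsum m i z 1)"
proof -
  have "Hsum m (Suc i) z u - Hsum m i z u =
      (\<Sum>k\<le>Suc (Suc m). (- z) ^ k * (Hslice m (Suc i) k u - Hslice m i k u))"
    by (simp add: Hsum_def right_diff_distrib sum_subtractf del: sum.atMost_Suc)
  \<comment> \<open>The slices for \<open>k = 0\<close> equal 1 and cancel.\<close>
  also have "\<dots> = (\<Sum>k\<le>Suc m. (- z) ^ Suc k * (Hslice m (Suc i) (Suc k) u - Hslice m i (Suc k) u))"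
    by (subst sum.atMost_Suc_shift) (simp add: Hslice_0 del: sum.atMost_Suc)
  finally have "(u - 1) * (Hsum m (Suc i) z u - Hsum m i z u) =
      (\<Sum>k\<le>Suc m. (- z) ^ Suc k * ((u - 1) * (Hslice m (Suc i) (Suc k) u - Hslice m i (Suc k) u)))"
    by (simp add: sum_distrib_left mult.left_commute del: sum.atMost_Suc)
  also have "\<dots> = z * (\<Sum>k\<le>Suc m. (- z) ^ k * (Hslice m i k u - u ^ (m - i) * Hslice m i k 1))"
    unfolding Hslice_Suc[OF i] sum_distrib_left by (intro sum.cong) (auto simp: algebra_simps)
  \<comment> \<open>The added term is 0: for \<open>i \<le> m\<close> all coefficients with
    \<open>k = m + 2\<close> vanish.\<close>
  also have "(\<Sum>k\<le>Suc m. (- z) ^ k * (Hslice m i k u - u ^ (m - i) * Hslice m i k 1)) =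
      (\<Sum>k\<le>m + 2. (- z) ^ k * (Hslice m i k u - u ^ (m - i) * Hslice m i k 1))"
  proof -
    have "Hcoeff m i (Suc (Suc m)) j = 0" for j
      using i by (auto simp: Hcoeff_def binomial_eq_0)
    then have "Hslice m i (Suc (Suc m)) v = 0" for v :: 'a
      by (simp only: Hslice_def) simp
    then show ?thesis by simp
  qed
  also have "\<dots> = Hsum m i z u - u ^ (m - i) * Hsum m i z 1"
    by (simp add: Hsum_def right_diff_distrib sum_subtractf sum_distrib_left mult.left_commute del: sum.atMost_Suc)
  finally show ?thesis .
qed

section \<open>Comparison of \<open>Hsum\<close> with the closed formula for
  \<open>H\<close>\<close>

lemma Hslice_split:
  assumes "i \<le> m" "0 < k"
  shows "Hslice m i k u =
    of_nat (Suc i choose k) * (\<Sum>e=0..m - i. of_nat (e + k - 1 choose e) * u ^ e) +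
    of_nat (m + k - i - 1 choose (k - 1)) *
      (\<Sum>j=Suc m - i..Suc m. of_nat (Suc m - j choose k) * u ^ j)"
proof -
  have "{..Suc m} = {0..m - i} \<union> {Suc m - i..Suc m}" "{0..m - i} \<inter> {Suc m - i..Suc m} = {}"
    using assms by auto
  then have "Hslice m i k u = (\<Sum>j=0..m - i. of_nat (Hcoeff m i k j) * u ^ j) +
      (\<Sum>j=Suc m - i..Suc m. of_nat (Hcoeff m i k j) * u ^ j)"
    unfolding Hslice_def by (simp only: sum.union_disjoint finite_atLeastAtMost)
  moreover have "(\<Sum>j=0..m - i. of_nat (Hcoeff m i k j) * u ^ j) =
      of_nat (Suc i choose k) * (\<Sum>e=0..m - i. of_nat (e + k - 1 choose e) * u ^ e)"
    unfolding sum_distrib_left using assms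
    by (intro sum.cong) (auto simp: Hcoeff_def mult.assoc)
  moreover have "(\<Sum>j=Suc m - i..Suc m. of_nat (Hcoeff m i k j) * u ^ j) =
      of_nat (m + k - i - 1 choose (k - 1)) *
      (\<Sum>j=Suc m - i..Suc m. of_nat (Suc m - j choose k) * u ^ j)"
    unfolding sum_distrib_left using assms
    by (intro sum.cong) (auto simp: Hcoeff_def mult.assoc)
  ultimately show ?thesis by simp
qed

text \<open>The terms with \<open>j > m + 1 - k\<close> vanish; \<open>e = m + 1 - k - j\<close>
  reverses the others.\<close>

lemma sum_high_binomials:
  fixes u :: "'a::comm_ring_1"
  assumes "i \<le> m" "k \<le> i"
  shows "(\<Sum>j=Suc m - i..Suc m. of_nat (Suc m - j choose k) * u ^ j) =
    (\<Sum>e=0..i - k. of_nat (e + k choose e) * u ^ (m + 1 - k - e))"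
proof -
  have "(\<Sum>j=Suc m - i..Suc m. of_nat (Suc m - j choose k) * u ^ j) =
      (\<Sum>j=Suc m - i..Suc m - k. of_nat (Suc m - j choose k) * u ^ j)"
    using assms by (intro sum.mono_neutral_right) (auto simp: binomial_eq_0)
  also have "\<dots> = (\<Sum>e=0..i - k. of_nat (e + k choose k) * u ^ (m + 1 - k - e))"
    using assms by (intro sum.reindex_bij_witness[of _ "\<lambda>e. Suc m - k - e" "\<lambda>j. Suc m - k - j"]) auto
  also have "\<dots> = (\<Sum>e=0..i - k. of_nat (e + k choose e) * u ^ (m + 1 - k - e))"
  proof -
    have "e + k choose k = e + k choose e" for e using binomial_symmetric[of k "e + k"] by simp
    then show ?thesis by simp
  qed
  finally show ?thesis .
qed

lemma H_eq_Hsum: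
  fixes u z :: "'a::comm_ring_1"
  assumes "i \<le> m + 1"
  shows "H m i z u = u ^ (i + 1) * Hsum m i z u"
proof (cases "i = m + 1")
  case True
  \<comment> \<open>For \<open>k \<ge> 2\<close> the factor \<open>k - 2 choose (k - 1)\<close> is
    0, so two slices remain.\<close>
  have "Hsum m i z u = (\<Sum>k\<in>{0, 1}. (- z) ^ k * Hslice m i k u)"
    unfolding Hsum_def
  proof (rule sum.mono_neutral_right)
    show "\<forall>k\<in>{..m + 2} - {0, 1}. (- z) ^ k * Hslice m i k u = 0"
    proof
      fix k assume "k \<in> {..m + 2} - {0, 1}"
      then have "Hcoeff m i k j = 0" for j
        using True by (auto simp: Hcoeff_def binomial_eq_0)
      then show "(- z) ^ k * Hslice m i k u = 0" by (simp only: Hslice_def) simp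
    qed
  qed auto
  also have "\<dots> = 1 - z * Hslice m i 1 u" by (simp add: Hslice_0)
  also have "Hslice m i 1 u = (\<Sum>j\<le>Suc m. u ^ j * of_nat (m + 1 - j))"
    unfolding Hslice_def using True by (intro sum.cong) (auto simp: Hcoeff_def)
  also have "\<dots> = (\<Sum>j=0..m. u ^ j * of_nat (m + 1 - j))"
    by (simp add: atLeast0AtMost)
  finally show ?thesis by (simp add: H_def True)
next
  case False
  then have i: "i \<le> m" using assms by simp
  define P where "P k = (- z) ^ k * of_nat (Suc i choose k) *
      (\<Sum>e=0..m - i. of_nat (e + k - 1 choose e) * u ^ e)" for k
  define Q where "Q k = (- z) ^ k * of_nat (m + k - i - 1 choose (k - 1)) *
      (\<Sum>j=Suc m - i..Suc m. of_nat (Suc m - j choose k) * u ^ j)" for k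
  have "Hsum m i z u = 1 + (\<Sum>k=1..m + 2. (- z) ^ k * Hslice m i k u)"
  proof -
    have "{..m + 2} = insert 0 {1..m + 2}" by auto
    then show ?thesis unfolding Hsum_def by (simp add: Hslice_0)
  qed
  also have "(\<Sum>k=1..m + 2. (- z) ^ k * Hslice m i k u) = (\<Sum>k=1..m + 2. P k + Q k)"
    using i by (intro sum.cong) (auto simp: Hslice_split P_def Q_def algebra_simps)
  also have "\<dots> = (\<Sum>k=1..m + 2. P k) + (\<Sum>k=1..m + 2. Q k)" by (rule sum.distrib)
  also have "(\<Sum>k=1..m + 2. P k) = (\<Sum>k=1..i + 1. P k)"
    using i by (intro sum.mono_neutral_right) (auto simp: P_def binomial_eq_0)
  also have "(\<Sum>k=1..m + 2. Q k) = (\<Sum>k=1..i. Q k)"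
  proof (intro sum.mono_neutral_right ballI)
    fix k assume "k \<in> {1..m + 2} - {1..i}"
    then have "(\<Sum>j=Suc m - i..Suc m. of_nat (Suc m - j choose k) * u ^ j) = 0"
      by (intro sum.neutral) (auto simp: binomial_eq_0)
    then show "Q k = 0" by (simp add: Q_def)
  qed (use i in auto)
  also have "\<dots> = (\<Sum>k=1..i. (- z) ^ k * of_nat (m + k - i - 1 choose (k - 1)) *
      (\<Sum>e=0..i - k. of_nat (e + k choose e) * u ^ (m + 1 - k - e)))"
    unfolding Q_def using i by (intro sum.cong refl) (subst sum_high_binomials, auto)
  finally show ?thesis using False by (simp add: H_def P_def add.assoc)
qed

lemma H_Suc:
  fixes u z :: "'a::comm_ring_1"
  assumes "i \<le> m"
  shows "(u - 1) * H m (Suc i) z u =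
    u * (u - 1) * H m i z u + z * u * (H m i z u - u ^ (m + 1) * H m i z 1)"
proof -
  have "m + 1 = (i + 1) + (m - i)" using assms by simp
  then have "u ^ (m + 1) = u ^ (i + 1) * u ^ (m - i)" by (metis power_add)
  then have "u * (u - 1) * H m i z u + z * u * (H m i z u - u ^ (m + 1) * H m i z 1) =
      u ^ (i + 2) * ((u - 1) * Hsum m i z u + z * (Hsum m i z u - u ^ (m - i) * Hsum m i z 1))"
    using assms by (simp add: H_eq_Hsum algebra_simps)
  also have "\<dots> = u ^ (i + 2) * ((u - 1) * Hsum m (Suc i) z u)"
    unfolding Hsum_Suc[OF assms, symmetric] by (simp add: algebra_simps)
  finally show ?thesis using assms by (simp add: H_eq_Hsum algebra_simps)
qed

lemma H_0: "H m 0 z u = u * (1 - z * (\<Sum>e=0..m. u ^ e))"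
  by (simp add: H_def)

text \<open>At \<open>u = U\<close> the first term of the bracket is
  \<open>x (1 - (m + 1) Z)\<close>, so the bracket becomes \<open>(x - 1) (1 - (m + 1) Z)\<close>;
  this links the two closed forms of \<open>I\<close>.\<close>

lemma H_top:
  fixes u z :: "'a::comm_ring_1"
  shows "(u - 1) * H m (m + 1) z u =
    u ^ (m + 2) * (u * (1 - z * (\<Sum>e=0..m. u ^ e)) - (1 - of_nat (m + 1) * z))"
proof -
  define S where "S m = (\<Sum>e=0..m. u ^ e * of_nat (m + 1 - e))" for m
  define T where "T m = (\<Sum>e=0..m. u ^ e)" for m
  have "(u - 1) * S m = u * T m - of_nat (m + 1)"
  proof (induction m)
    case (Suc m)
    have "S (Suc m) = S m + T (Suc m)"
      by (simp add: S_def T_def sum.distrib[symmetric] Suc_diff_le algebra_simps)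
    moreover have "(u - 1) * T (Suc m) = u * u ^ Suc m - 1"
      using power_diff_1_eq[of u "Suc (Suc m)"]
      by (simp add: T_def atLeast0AtMost lessThan_Suc_atMost del: sum.atMost_Suc)
    moreover have "T (Suc m) = T m + u ^ Suc m" by (simp add: T_def)
    ultimately show ?case using Suc by (simp add: distrib_left)
  qed (simp add: S_def T_def)
  moreover have "H m (m + 1) z u = u ^ (m + 2) * (1 - z * S m)" by (simp add: H_def S_def)
  ultimately have "(u - 1) * H m (m + 1) z u =
      u ^ (m + 2) * (u - 1 - z * (u * T m - of_nat (m + 1)))"
    by (metis (no_types, lifting) mult.left_commute mult_1_right right_diff_distrib)
  then show ?thesis by (simp only: T_def) (simp only: mult_1_left mult_1_right algebra_simps)
qed

section \<open>The series Z and U\<close>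

text \<open>Serves for the inclusion \<open>lift\<close>, the specialisation \<open>at_x1\<close>
  and the embedding \<open>emb\<close>, which must all commute with the evaluation of
  \<open>H\<close>.\<close>

locale unital_ring_hom =
  fixes f :: "'a::comm_ring_1 \<Rightarrow> 'b::comm_ring_1"
  assumes add: "f (a + b) = f a + f b"
    and mult: "f (a * b) = f a * f b"
    and one: "f 1 = 1"
begin

lemma zero: "f 0 = 0"
  using add[of 0 0] by simp

lemma uminus: "f (- a) = - f a"
  using add[of a "- a"] by (simp add: zero eq_neg_iff_add_eq_0 add.commute)

lemma diff: "f (a - b) = f a - f b"
  using add[of a "- b"] by (simp add: uminus)

lemma power: "f (a ^ n) = f a ^ n"
  by (induction n) (simp_all add: one mult)

lemma of_nat: "f (of_nat n) = of_nat n"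
  by (induction n) (simp_all add: zero one add)

lemma sum: "f (sum g A) = (\<Sum>x\<in>A. f (g x))"
  by (induction A rule: infinite_finite_induct) (simp_all add: zero add)

lemmas hom_simps = add mult one zero uminus diff power of_nat sum

lemma H: "f (H m i z u) = H m i (f z) (f u)"
  unfolding H_def by (simp add: hom_simps)

end

interpretation emb: unital_ring_hom emb
  by standard (simp_all add: emb_def One_fract_def)

lemma emb_eq_iff: "emb a = emb b \<longleftrightarrow> a = b"
  by (simp add: emb_def eq_fract)

interpretation lift: unital_ring_hom lift
proof
  show "lift (a * b) = lift a * lift b" for a b
  proof (rule fps_ext)
    fix n
    have "[:\<Sum>i=0..n. fps_nth a i * fps_nth b (n - i):] = (\<Sum>i=0..n. [:fps_nth a i * fps_nth b (n - i):])"
      by (induction n arbitrary: b) (simp_all add: sum_to_poly)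
    then show "fps_nth (lift (a * b)) n = fps_nth (lift a * lift b) n"
      by (simp add: lift_def fps_mult_nth mult_ac)
  qed
  show "lift (a + b) = lift a + lift b" for a b
    by (simp add: lift_def fps_eq_iff)
  show "lift 1 = 1"
    by (simp add: lift_def fps_eq_iff one_pCons)
qed

lemma lift_fps_X: "lift fps_X = fps_X"
  by (auto simp: lift_def fps_eq_iff fps_X_def one_pCons)

interpretation at_x1: unital_ring_hom at_x1
proof
  show "at_x1 (a + b) = at_x1 a + at_x1 b" for a b
    by (simp add: at_x1_def fps_eq_iff)
  show "at_x1 (a * b) = at_x1 a * at_x1 b" for a b
    by (simp add: at_x1_def fps_eq_iff fps_mult_nth poly_sum)
  show "at_x1 1 = 1"
    by (simp add: at_x1_def fps_eq_iff)
qed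

lemma at_x1_lift: "at_x1 (lift F) = F"
  by (simp add: at_x1_def lift_def fps_eq_iff)

lemma at_x1_x_series: "at_x1 x_series = 1"
  by (simp add: at_x1_def fps_eq_iff)

lemma embZ_eq: "embZ F = emb (lift F)"
  by (simp add: embZ_def lift_def)

section \<open>Congruence modulo \<open>t^n\<close> and fixed points of t-adic contractions\<close>

definition agree :: "nat \<Rightarrow> 'a::zero fps \<Rightarrow> 'a fps \<Rightarrow> bool" where
  "agree n F G \<longleftrightarrow> (\<forall>k<n. fps_nth F k = fps_nth G k)"

lemma agree_refl [simp]: "agree n F F"
  by (simp add: agree_def)

lemma agree_add: "agree n F F' \<Longrightarrow> agree n G G' \<Longrightarrow> agree n (F + G) (F' + G')"
  by (simp add: agree_def)

lemma agree_diff: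
  fixes F G :: "'a::ab_group_add fps"
  shows "agree n F F' \<Longrightarrow> agree n G G' \<Longrightarrow> agree n (F - G) (F' - G')"
  by (simp add: agree_def)

lemma agree_mult:
  fixes F G :: "'a::semiring_0 fps"
  shows "agree n F F' \<Longrightarrow> agree n G G' \<Longrightarrow> agree n (F * G) (F' * G')"
  by (auto simp: agree_def fps_mult_nth intro!: sum.cong)

lemma agree_power:
  fixes F :: "'a::semiring_1 fps"
  shows "agree n F F' \<Longrightarrow> agree n (F ^ k) (F' ^ k)"
  by (induction k) (auto intro: agree_mult)

lemma agree_sum: "(\<And>i. i \<in> A \<Longrightarrow> agree n (f i) (g i)) \<Longrightarrow> agree n (sum f A) (sum g A)"
  by (simp add: agree_def fps_sum_nth)

text \<open>Without constant terms in the factors, the coefficient of degree \<open>n\<close> of the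
  product uses only coefficients of lower degree.\<close>

lemma agree_Suc_mult:
  fixes F G :: "'a::semiring_0 fps"
  assumes "agree n F F'" "agree n G G'" "fps_nth F 0 = 0" "fps_nth F' 0 = 0" "fps_nth G 0 = 0" "fps_nth G' 0 = 0"
  shows "agree (Suc n) (F * G) (F' * G')"
  unfolding agree_def
proof (intro allI impI)
  fix k assume "k < Suc n"
  have "fps_nth F i * fps_nth G (k - i) = fps_nth F' i * fps_nth G' (k - i)" if "i \<le> k" for i
    using assms that \<open>k < Suc n\<close>
    by (cases "i = 0"; cases "i = k") (auto simp: agree_def)
  then show "fps_nth (F * G) k = fps_nth (F' * G') k"
    by (simp add: fps_mult_nth)
qed

lemma agree_Suc_mult_left:
  fixes F G :: "'a::semiring_0 fps"
  assumes "agree n G G'" "fps_nth F 0 = 0"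
  shows "agree (Suc n) (F * G) (F * G')"
  unfolding agree_def
proof (intro allI impI)
  fix k assume "k < Suc n"
  have "fps_nth F i * fps_nth G (k - i) = fps_nth F i * fps_nth G' (k - i)" if "i \<le> k" for i
    using assms that \<open>k < Suc n\<close> by (cases "i = 0") (auto simp: agree_def)
  then show "fps_nth (F * G) k = fps_nth (F * G') k"
    by (simp add: fps_mult_nth)
qed

text \<open>The t-adic form of Banach's theorem: the coefficient \<open>n\<close> of the iterates
  from 0 is constant from iterate \<open>n + 1\<close> on, and these values form the fixed
  point.\<close>

lemma fps_contraction_fixpoint:
  fixes \<Phi> :: "'a::zero fps \<Rightarrow> 'a fps"
  assumes contr: "\<And>n F G. agree n F G \<Longrightarrow> agree (Suc n) (\<Phi> F) (\<Phi> G)"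
  shows "\<exists>!F. F = \<Phi> F"
proof (rule ex_ex1I)
  define F where "F = Abs_fps (\<lambda>n. fps_nth ((\<Phi> ^^ Suc n) 0) n)"
  have step: "agree n ((\<Phi> ^^ n) 0) ((\<Phi> ^^ (n + p)) 0)" for n p
    by (induction n) (auto intro: contr simp: agree_def[of 0])
  have "agree n ((\<Phi> ^^ n) 0) F" for n
    unfolding agree_def
  proof (intro allI impI)
    fix k assume "k < n"
    then show "fps_nth ((\<Phi> ^^ n) 0) k = fps_nth F k"
      using step[of "Suc k" "n - Suc k"] by (simp add: agree_def F_def)
  qed
  then have *: "agree (Suc n) ((\<Phi> ^^ Suc n) 0) (\<Phi> F)" for n
    using contr by simp
  have "F = \<Phi> F"
  proof (rule fps_ext)
    fix n
    have "fps_nth F n = fps_nth ((\<Phi> ^^ Suc n) 0) n" by (simp add: F_def)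
    also have "\<dots> = fps_nth (\<Phi> F) n" using *[of n] unfolding agree_def by blast
    finally show "fps_nth F n = fps_nth (\<Phi> F) n" .
  qed
  then show "\<exists>F. F = \<Phi> F" by blast
next
  fix F G assume FG: "F = \<Phi> F" "G = \<Phi> G"
  have "agree n F G" for n
  proof (induction n)
    case (Suc n)
    from contr[OF Suc] show ?case by (simp flip: FG)
  qed (simp add: agree_def)
  then show "F = G" by (auto simp: fps_eq_iff agree_def)
qed

text \<open>Dividing out the factor \<open>t\<close> of \<open>Z\<close> turns its defining equation into a contraction.\<close>

lemma is_Z_fps_X_mult:
  "is_Z m (fps_X * W) \<longleftrightarrow>
     W = 1 + fps_X * (of_nat (m + 1) * W ^ 2 * (\<Sum>i<m. (1 - of_nat (m + 1) * (fps_X * W)) ^ i))"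
    (is "_ \<longleftrightarrow> W = 1 + fps_X * ?R")
proof -
  let ?y = "of_nat (m + 1) * (fps_X * W)"
  have "is_Z m (fps_X * W) \<longleftrightarrow> fps_X * 1 = fps_X * (W * (1 - ?y) ^ m)"
    by (simp only: is_Z_def mult.assoc) simp
  also have "\<dots> \<longleftrightarrow> 1 = W * (1 - ?y) ^ m"
    unfolding mult_cancel_left by simp
  also have "\<dots> \<longleftrightarrow> W = 1 + W * (1 - (1 - ?y) ^ m)"
    by (auto simp: right_diff_distrib)
  also have "1 - (1 - ?y) ^ m = ?y * (\<Sum>i<m. (1 - ?y) ^ i)"
    by (subst one_diff_power_eq) simp
  also have "W * \<dots> = fps_X * ?R" by (simp add: power2_eq_square mult_ac del: of_nat_Suc of_nat_add)
  finally show ?thesis .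
qed

lemma is_Z_unique: "\<exists>!Z. is_Z m Z"
proof -
  define \<Phi> where "\<Phi> W = 1 + fps_X * (of_nat (m + 1) * W ^ 2 *
    (\<Sum>i<m. (1 - of_nat (m + 1) * (fps_X * W)) ^ i))" for W :: "rat fps"
  have "\<exists>!W. W = \<Phi> W"
    unfolding \<Phi>_def
    by (intro fps_contraction_fixpoint agree_add agree_refl agree_Suc_mult_left agree_mult
        agree_power agree_sum agree_diff) simp_all
  then obtain W where W: "W = \<Phi> W" "\<And>W'. W' = \<Phi> W' \<Longrightarrow> W' = W" by blast
  show ?thesis
  proof (rule ex1I)
    show "is_Z m (fps_X * W)" using W(1) unfolding is_Z_fps_X_mult \<Phi>_def .
    fix Z assume Z: "is_Z m Z"
    \<comment> \<open>Every solution has constant term 0 and so is \<open>t\<close> times some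
      \<open>W\<close>.\<close>
    then have "Z = fps_X * fps_shift 1 Z"
      by (auto simp: is_Z_def fps_eq_iff split: nat.splits)
    then show "Z = fps_X * W"
      using Z W(2)[of "fps_shift 1 Z"] is_Z_fps_X_mult[of m "fps_shift 1 Z"] unfolding \<Phi>_def by metis
  qed
qed

text \<open>Solved for its leading \<open>U\<close>, the equation is a contraction because
  \<open>z\<close> is a multiple of \<open>t\<close>.\<close>

lemma kernel_equation_unique:
  fixes a z :: "'a::comm_ring_1 fps"
  assumes "fps_nth z 0 = 0"
  shows "\<exists>!U. a = U * (1 - z * (\<Sum>e=0..m. U ^ e))"
proof -
  have "\<exists>!U. U = a + z * (U * (\<Sum>e=0..m. U ^ e))"
    by (intro fps_contraction_fixpoint agree_add agree_refl agree_Suc_mult_left agree_mult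
        agree_power agree_sum assms)
  moreover have "a = U * (1 - z * (\<Sum>e=0..m. U ^ e)) \<longleftrightarrow> U = a + z * (U * (\<Sum>e=0..m. U ^ e))" for U
    by (auto simp: algebra_simps)
  ultimately show ?thesis by simp
qed

lemma is_U_iff:
  assumes Z: "is_Z m Z"
  shows "is_U m Z U \<longleftrightarrow>
    x_series * (1 - of_nat (m + 1) * lift Z) = U * (1 - lift Z * (\<Sum>e=0..m. U ^ e))"
proof -
  define c where "c = 1 - of_nat (m + 1) * lift Z"
  have z0: "fps_nth (lift Z) 0 = 0" using Z by (simp add: is_Z_def lift_def)
  then have c0: "fps_nth c 0 = 1" by (simp add: c_def)
  then have "c \<noteq> 0" by auto
  then have c: "emb c \<noteq> 0" using emb_eq_iff[of c 0] by (simp add: emb.zero)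
  have ec: "1 - of_nat (m + 1) * embZ Z = emb c"
    by (simp add: c_def embZ_eq emb.hom_simps)
  have [simp]: "[:0, 1::rat:] \<noteq> 1" by (simp add: one_pCons)
  show ?thesis
  proof (cases "U = 1")
    \<comment> \<open>Division by 0 makes the quotient 0, so \<open>is_U\<close> would say
      \<open>x (1 - (m + 1) Z) = 1\<close>. Its constant term \<open>x = 1\<close> is absurd; the
      polynomial equation fails for the same reason.\<close>
    case True
    have "is_U m Z U \<longleftrightarrow> emb x_series * emb c = emb 1"
      unfolding is_U_def ec using c by (simp add: True X_def emb.one field_simps)
    also have "\<dots> \<longleftrightarrow> x_series * c = 1" by (simp flip: emb.mult add: emb_eq_iff)
    also have "\<not> \<dots>"
    proof
      assume "x_series * c = 1"
      then have "fps_nth (x_series * c) 0 = 1" by simp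
      then show False using c0 by simp
    qed
    moreover have "\<not> x_series * c = U * (1 - lift Z * (\<Sum>e=0..m. U ^ e))"
    proof
      assume "x_series * c = U * (1 - lift Z * (\<Sum>e=0..m. U ^ e))"
      then have "fps_nth (x_series * c) 0 = fps_nth (U * (1 - lift Z * (\<Sum>e=0..m. U ^ e))) 0" by simp
      then show False using c0 z0 True by simp
    qed
    ultimately show ?thesis by (simp add: c_def)
  next
    case False
    then have "emb U \<noteq> 1" using emb_eq_iff[of U 1] by (simp add: emb.one)
    then have "(emb U ^ (m + 1) - 1) / (emb U - 1) = (\<Sum>e=0..m. emb U ^ e)"
      using power_diff_1_eq[of "emb U" "m + 1"]
      by (simp add: atLeast0AtMost lessThan_Suc_atMost)
    then have "is_U m Z U \<longleftrightarrow> emb x_series * emb c = emb U * (1 - embZ Z * (\<Sum>e=0..m. emb U ^ e))"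
      unfolding is_U_def ec using c by (simp add: X_def field_simps)
    also have "\<dots> \<longleftrightarrow> emb (x_series * c) = emb (U * (1 - lift Z * (\<Sum>e=0..m. U ^ e)))"
      by (simp only: emb.hom_simps embZ_eq)
    finally show ?thesis by (simp only: emb_eq_iff c_def)
  qed
qed

section \<open>Solving the functional equations\<close>

text \<open>
  Every \<open>L i\<close> and \<open>M\<close> is a multiple of \<open>t\<close>, so the coefficient of degree \<open>n\<close> of the product
  involves \<open>L\<close> and \<open>M\<close> only through lower coefficients.
\<close>

lemma system_unique:
  fixes L L' :: "nat \<Rightarrow> rat poly fps"
  assumes L0: "L 0 = L' 0" "fps_nth (L 0) 0 = 0"
    and M: "x_series ^ r * M = L (Suc m)" "x_series ^ r * M' = L' (Suc m)"
    and L: "\<And>i. i \<le> m \<Longrightarrow> (x_series - 1) * L (Suc i) =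
      (x_series - 1) * x_series * L i + M * (L i - x_series ^ r * lift (at_x1 (L i)))"
    and L': "\<And>i. i \<le> m \<Longrightarrow> (x_series - 1) * L' (Suc i) =
      (x_series - 1) * x_series * L' i + M' * (L' i - x_series ^ r * lift (at_x1 (L' i)))"
    and i: "i \<le> Suc m"
  shows "L i = L' i"
proof -
  let ?x1 = "[:-1, 1::rat:]"
  have x1: "x_series - 1 = fps_const ?x1"
    by (simp flip: fps_const_1_eq_1 add: fps_const_sub one_pCons)
  have xr: "x_series ^ r = fps_const ([:0, 1:] ^ r)" by (simp add: fps_const_power)
  have la: "fps_nth (lift (at_x1 F)) n = [:poly (fps_nth F n) 1:]" for F n
    by (simp add: lift_def at_x1_def)
  have zero: "i \<le> Suc m \<Longrightarrow> fps_nth (L i) 0 = 0"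
    if L0: "fps_nth (L 0) 0 = 0" and L: "\<And>i. i \<le> m \<Longrightarrow> (x_series - 1) * L (Suc i) =
      (x_series - 1) * x_series * L i + M * (L i - x_series ^ r * lift (at_x1 (L i)))" for L M i
  proof (induction i)
    case (Suc i)
    have "fps_nth ((x_series - 1) * L (Suc i)) 0 = 0"
      using Suc by (subst L) (auto simp: la)
    then show ?case by (simp add: x1 del: mult_pCons_left)
  qed (use L0 in simp)
  have M0: "fps_nth M 0 = 0" if "x_series ^ r * M = F" "fps_nth F 0 = 0" for M F
  proof -
    have "[:0, 1:] ^ r * fps_nth M 0 = 0" using that by (auto simp: xr)
    then show ?thesis by simp
  qed
  have L'0: "fps_nth (L' 0) 0 = 0" using L0 by simp
  note z = zero[OF L0(2) L] zero[OF L'0 L']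
  have *: "\<forall>i\<le>Suc m. agree n (L i) (L' i)" for n
  proof (induction n)
    case (Suc n)
    \<comment> \<open>Powers of \<open>x\<close> cancel coefficientwise, so \<open>M\<close>
      inherits the precision of \<open>L (Suc m)\<close>.\<close>
    have "agree n M M'"
      unfolding agree_def
    proof (intro allI impI)
      fix k assume "k < n"
      moreover have "agree n (x_series ^ r * M) (x_series ^ r * M')" unfolding M using Suc by simp
      ultimately have "fps_nth (x_series ^ r * M) k = fps_nth (x_series ^ r * M') k"
        unfolding agree_def by blast
      then show "fps_nth M k = fps_nth M' k" by (simp add: xr)
    qed
    show ?case
    proof (intro allI impI)
      \<comment> \<open>Ascending in \<open>i\<close>, the linear term needs \<open>L i\<close> at
        precision \<open>n + 1\<close>, the product only at precision \<open>n\<close>.\<close>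
      fix i assume "i \<le> Suc m"
      then show "agree (Suc n) (L i) (L' i)"
      proof (induction i)
        case (Suc i)
        have i: "i \<le> m" "i \<le> Suc m" using Suc.prems by auto
        have a: "agree n (L i) (L' i)" using \<open>\<forall>i\<le>Suc m. agree n (L i) (L' i)\<close> i by blast
        then have "agree n (lift (at_x1 (L i))) (lift (at_x1 (L' i)))" by (simp add: agree_def la)
        then have "agree (Suc n) (M * (L i - x_series ^ r * lift (at_x1 (L i))))
            (M' * (L' i - x_series ^ r * lift (at_x1 (L' i))))"
          using a \<open>agree n M M'\<close> z i M0[OF M(1)] M0[OF M(2)]
          by (intro agree_Suc_mult agree_diff agree_mult agree_refl) (simp_all add: la)
        then have "agree (Suc n) ((x_series - 1) * L (Suc i)) ((x_series - 1) * L' (Suc i))"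
          unfolding L[OF i(1)] L'[OF i(1)] using Suc.IH[OF i(2)]
          by (rule agree_add[OF agree_mult[OF agree_refl], rotated])
        then show ?case by (simp add: agree_def x1 del: mult_pCons_left)
      qed (simp add: L0)
    qed
  qed (simp add: agree_def)
  show ?thesis using *[rule_format, OF i] by (auto simp: fps_eq_iff agree_def)
qed

lemma H_at_1: "H m (m + 1) z 1 = 1 - of_nat ((m + 2) choose 2) * z"
proof -
  have "(\<Sum>e=0..m. m + 1 - e) = (m + 2) choose 2"
  proof (induction m)
    case (Suc m)
    have "(\<Sum>e=0..m. Suc m + 1 - e) = (\<Sum>e=0..m. (m + 1 - e) + 1)"
      by (intro sum.cong) auto
    then have "(\<Sum>e=0..Suc m. Suc m + 1 - e) = (\<Sum>e=0..m. (m + 1 - e) + 1) + 1"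
      by simp
    also have "\<dots> = ((m + 2) choose 2) + (m + 2)"
      unfolding sum.distrib Suc by simp
    finally show ?case by (simp add: numeral_2_eq_2)
  qed (simp add: numeral_2_eq_2)
  then have "(\<Sum>e=0..m. of_nat (m + 1 - e)) = (of_nat ((m + 2) choose 2) :: 'a)"
    by (metis of_nat_sum)
  then show ?thesis by (simp add: H_def mult.commute)
qed

lemma at_x1_x_series_power: "at_x1 (x_series ^ k * F) = at_x1 F"
  by (simp only: at_x1.mult at_x1.power at_x1_x_series power_one mult_1_left)

section \<open>The claimed series as a solution of the system\<close>

locale greedy_tamari_parametrisation =
  fixes m :: nat and Z :: "rat fps" and U :: "rat poly fps"
  assumes Z: "is_Z m Z" and U: "is_U m Z U"
begin

definition z where "z = lift Z"
definition c where "c = 1 - of_nat (m + 1) * z"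
text \<open>The inverse is formed over the field of rationals and then lifted. With it,
  \<open>c ^ (m + 1 - i) * c_inv ^ 2\<close> expresses the power of \<open>c\<close> with exponent
  \<open>m - i - 1\<close>, which is negative for \<open>i = m\<close> and
  \<open>i = m + 1\<close>.\<close>

definition c_inv where "c_inv = lift (inverse (1 - of_nat (m + 1) * Z))"

text \<open>The claimed value of \<open>J\<^sub>i / x\<^sup>m\<^sup>-\<^sup>i\<^sup>-\<^sup>1\<close>.\<close>

definition K :: "nat \<Rightarrow> rat poly fps" where
  "K i = z * c ^ (m + 1 - i) * c_inv ^ 2 * H m i z U"

lemma Z0: "fps_nth Z 0 = 0"
  using Z by (simp add: is_Z_def)

lemma z0: "fps_nth z 0 = 0"
  by (simp add: z_def lift_def Z0)

lemma c_eq: "c = lift (1 - of_nat (m + 1) * Z)"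
  by (simp add: c_def z_def lift.hom_simps)

lemma c_inv: "c * c_inv = 1"
proof -
  have "(1 - of_nat (m + 1) * Z) * inverse (1 - of_nat (m + 1) * Z) = 1"
    by (rule inverse_mult_eq_1') (simp add: Z0)
  then show ?thesis unfolding c_eq c_inv_def by (metis lift.mult lift.one)
qed

lemma c_neq_0: "c \<noteq> 0"
  using c_inv by auto

lemma t_eq: "fps_X = z * c ^ m"
  using Z unfolding is_Z_def c_eq z_def by (metis lift.mult lift.power lift_fps_X)

lemma U_eq: "x_series * c = U * (1 - z * (\<Sum>e=0..m. U ^ e))"
  using is_U_iff[OF Z] U by (simp add: c_def z_def)

lemma U_neq_1: "U \<noteq> 1"
proof
  assume "U = 1"
  then have "fps_nth (x_series * c) 0 = 1" unfolding U_eq by (simp add: z0)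
  then have "[:0, 1::rat:] = 1" by (simp add: c_def z0)
  then show False by (simp add: one_pCons)
qed

lemma at_x1_z: "at_x1 z = Z"
  by (simp add: z_def at_x1_lift)

text \<open>At \<open>x = 1\<close> the constant 1 also solves the kernel equation, the geometric
  sum being \<open>m + 1\<close>, and the solution is unique.\<close>

lemma at_x1_U: "at_x1 U = 1"
proof -
  have "at_x1 (x_series * c) = at_x1 (U * (1 - z * (\<Sum>e=0..m. U ^ e)))" unfolding U_eq ..
  then have "1 - of_nat (m + 1) * Z = at_x1 U * (1 - Z * (\<Sum>e=0..m. at_x1 U ^ e))"
    by (simp add: at_x1.hom_simps at_x1_x_series c_eq at_x1_lift at_x1_z)
  moreover have "1 - of_nat (m + 1) * Z = 1 * (1 - Z * (\<Sum>e=0..m. 1 ^ e))"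
    by (simp add: mult.commute)
  ultimately show ?thesis using kernel_equation_unique[OF Z0] by blast
qed

lemma K_0: "K 0 = fps_X * x_series"
proof -
  have "K 0 = z * c ^ m * c_inv * (c * c_inv) * H m 0 z U"
    by (simp add: K_def power2_eq_square mult_ac)
  also have "H m 0 z U = x_series * c" unfolding H_0 U_eq ..
  finally have "K 0 = z * c ^ m * x_series * (c * c_inv) * (c * c_inv)" by (simp add: mult_ac)
  then show ?thesis by (simp add: c_inv t_eq)
qed

lemma K_top: "(U - 1) * K (m + 1) = z * U ^ (m + 2) * c_inv * (x_series - 1)"
proof -
  have "(U - 1) * K (m + 1) = z * c_inv ^ 2 * ((U - 1) * H m (m + 1) z U)"
    by (simp add: K_def mult_ac)
  also have "(U - 1) * H m (m + 1) z U = U ^ (m + 2) * (x_series * c - c)"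
    unfolding H_top U_eq by (simp only: c_def)
  also have "z * c_inv ^ 2 * (U ^ (m + 2) * (x_series * c - c)) =
      z * U ^ (m + 2) * c_inv * (x_series - 1) * (c * c_inv)"
    by (simp add: algebra_simps power2_eq_square)
  finally show ?thesis by (simp add: c_inv)
qed

lemma lift_at_x1_K:
  "lift (at_x1 (K i)) = z * c ^ (m + 1 - i) * c_inv ^ 2 * H m i z 1"
proof -
  have "lift (at_x1 z) = z" "lift (at_x1 c) = c" "lift (at_x1 c_inv) = c_inv"
    by (simp_all only: z_def c_eq c_inv_def at_x1_lift)
  then show ?thesis
    by (simp only: K_def at_x1.mult at_x1.power at_x1.H at_x1_U lift.mult lift.power lift.H lift.one)
qed

text \<open>After multiplication by \<open>U - 1\<close>, the kernel equation replaces
  \<open>U (U - 1) + z U\<close> in the recurrence for \<open>H\<close> by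
  \<open>(U - 1) x c + z U^(m+2)\<close>. The term left over, \<open>z U^(m+2) (h - h1)\<close>,
  becomes the product with \<open>K (m + 1)\<close> by \<open>K_top\<close>.\<close>

lemma K_Suc:
  assumes i: "i \<le> m"
  shows "(x_series - 1) * K (Suc i) =
    (x_series - 1) * x_series * K i + K (m + 1) * (K i - lift (at_x1 (K i)))"
proof -
  define h where "h = H m i z U"
  define h1 where "h1 = H m i z 1"
  define q where "q = z * c ^ (m - i) * c_inv ^ 2"
  have e: "m + 1 - i = Suc (m - i)" "m + 1 - Suc i = m - i" using i by auto
  have K: "K i = q * c * h" "K (Suc i) = q * H m (Suc i) z U" "lift (at_x1 (K i)) = q * c * h1"
    unfolding lift_at_x1_K unfolding K_def e q_def h_def h1_def by (simp_all only: power_Suc mult_ac)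
  have geom: "(U - 1) * (\<Sum>e=0..m. U ^ e) = U ^ (m + 1) - 1"
    using power_diff_1_eq[of U "m + 1"] by (simp add: atLeast0AtMost lessThan_Suc_atMost)
  have "(U - 1) * (x_series * c) = U * (U - 1 - z * ((U - 1) * (\<Sum>e=0..m. U ^ e)))"
    unfolding U_eq by (simp add: algebra_simps)
  then have xc: "(U - 1) * (x_series * c) = U * (U - 1) - z * U ^ (m + 2) + z * U"
    unfolding geom by (simp add: algebra_simps)
  have Hs: "(U - 1) * H m (Suc i) z U = (U - 1) * (x_series * c) * h + z * U ^ (m + 2) * (h - h1)"
    unfolding H_Suc[OF i] xc h_def[symmetric] h1_def[symmetric] by (simp add: algebra_simps)
  have "(U - 1) * ((x_series - 1) * K (Suc i)) = (x_series - 1) * q * ((U - 1) * H m (Suc i) z U)"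
    unfolding K by (simp only: mult_ac)
  \<comment> \<open>The factor \<open>c * c_inv = 1\<close> supplies the power of \<open>c\<close>
    by which \<open>K i\<close> and \<open>K (Suc i)\<close> differ.\<close>
  also have "\<dots> = (U - 1) * ((x_series - 1) * x_series * K i) +
      (x_series - 1) * q * (z * U ^ (m + 2) * (h - h1)) * (c * c_inv)"
    unfolding Hs K c_inv by (simp only: distrib_left mult_ac mult_1_right mult_1_left)
  also have "(x_series - 1) * q * (z * U ^ (m + 2) * (h - h1)) * (c * c_inv) =
      (z * U ^ (m + 2) * c_inv * (x_series - 1)) * (q * c * h - q * c * h1)"
    by (subst right_diff_distrib[of "q * c" h h1, symmetric]) (simp only: mult_ac)
  also have "\<dots> = (U - 1) * (K (m + 1) * (K i - lift (at_x1 (K i))))"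
    unfolding K_top[symmetric] K(3) unfolding K(1) by (simp only: mult_ac)
  finally have "(U - 1) * ((x_series - 1) * K (Suc i)) =
      (U - 1) * ((x_series - 1) * x_series * K i + K (m + 1) * (K i - lift (at_x1 (K i))))"
    by (simp only: distrib_left)
  then show ?thesis using U_neq_1 by simp
qed

text \<open>Multiplying \<open>J\<close> by \<open>x^(i+1)\<close> makes the coefficients of the
  system independent of \<open>i\<close>, and the common factor \<open>x^m\<close> on the other side
  avoids negative powers of \<open>x\<close>. The unknown factor of the product is then
  \<open>x^2 I\<close>, matched with \<open>K (m + 1)\<close>.\<close>

lemma J_eq_K:
  assumes "i \<le> m + 1"
  shows "x_series ^ (i + 1) * J_gf m i = x_series ^ m * K i"
proof (rule system_unique[where m = m and r = m and M = "x_series ^ 2 * I_gf m" and M' = "K (m + 1)"])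
  show "x_series ^ (0 + 1) * J_gf m 0 = x_series ^ m * K 0"
    by (simp add: J_gf_0 K_0 mult_ac)
  show "fps_nth (x_series ^ (0 + 1) * J_gf m 0) 0 = 0"
    by (simp add: J_gf_0)
  show "x_series ^ m * (x_series ^ 2 * I_gf m) = x_series ^ (Suc m + 1) * J_gf m (Suc m)"
    by (simp add: J_gf_top power2_eq_square mult_ac)
  show "x_series ^ m * K (m + 1) = x_series ^ m * K (Suc m)" by simp
  show "i \<le> Suc m" using assms by simp
next
  fix i assume i: "i \<le> m"
  have *: "(y - 1) * (yi * y * y * J') =
      (y - 1) * y * (yi * y * J) + y ^ 2 * I * (yi * y * J - yi * yr * E)"
    if "(y - 1) * J' = (y - 1) * J + I * (y * J - yr * E)" for y yi yr J J' I E :: "rat poly fps"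
  proof -
    have "(y - 1) * (yi * y * y * J') = yi * y * y * ((y - 1) * J')" by (simp only: mult_ac)
    then show ?thesis unfolding that by (simp add: algebra_simps power2_eq_square)
  qed
  have "x_series ^ m = x_series ^ i * x_series ^ (m - i)"
    using i by (metis le_add_diff_inverse power_add)
  moreover have "x_series ^ (i + 1) = x_series ^ i * x_series"
    "x_series ^ (Suc i + 1) = x_series ^ i * x_series * x_series"
    by (simp_all only: power_add power_Suc power_one_right mult_ac)
  ultimately show "(x_series - 1) * (x_series ^ (Suc i + 1) * J_gf m (Suc i)) =
    (x_series - 1) * x_series * (x_series ^ (i + 1) * J_gf m i) +
    x_series ^ 2 * I_gf m *
     (x_series ^ (i + 1) * J_gf m i - x_series ^ m * lift (at_x1 (x_series ^ (i + 1) * J_gf m i)))"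
    unfolding at_x1_x_series_power using *[OF J_gf_Suc[OF i], of "x_series ^ i"] by (simp only:)
next
  fix i assume "i \<le> m"
  have "at_x1 (x_series ^ m * K i) = at_x1 (K i)"
    by (rule at_x1_x_series_power)
  moreover have "(x_series - 1) * (x_series ^ m * K (Suc i)) = x_series ^ m * ((x_series - 1) * K (Suc i))"
    by (simp only: mult_ac)
  ultimately show "(x_series - 1) * (x_series ^ m * K (Suc i)) =
    (x_series - 1) * x_series * (x_series ^ m * K i) +
    K (m + 1) * (x_series ^ m * K i - x_series ^ m * lift (at_x1 (x_series ^ m * K i)))"
    unfolding K_Suc[OF \<open>i \<le> m\<close>] by (simp only:) (simp only: algebra_simps)
qed

lemma I_eq_K: "x_series ^ 2 * I_gf m = K (m + 1)"
proof -
  have "x_series ^ m * (x_series ^ 2 * I_gf m) = x_series ^ m * K (m + 1)"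
    using J_eq_K[of "m + 1"] J_gf_top[of m] by (simp add: power2_eq_square mult_ac)
  then show ?thesis by simp
qed

lemma emb_c: "1 - of_nat (m + 1) * embZ Z = emb c"
  by (simp add: c_def z_def embZ_eq emb.hom_simps)

lemma emb_c_neq_0: "emb c \<noteq> 0"
  using c_neq_0 emb_eq_iff[of c 0] by (simp add: emb.zero)

lemma emb_c_inv: "emb c_inv = 1 / emb c"
  using emb_c_neq_0 arg_cong[OF c_inv, of emb] by (simp add: emb.mult emb.one field_simps)

lemma X_neq_0: "X \<noteq> 0"
  using emb_eq_iff[of x_series 0] by (simp add: X_def emb.zero)

lemma emb_K: "emb (K i) = embZ Z * emb c ^ (m + 1 - i) / emb c ^ 2 * H m i (embZ Z) (emb U)"
  by (simp add: K_def emb.hom_simps emb.H emb_c_inv embZ_eq z_def power_divide)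

lemma I_formula:
  "X ^ 2 * emb (I_gf m) =
     embZ Z * emb U ^ (m + 2) / (1 - of_nat (m + 1) * embZ Z) ^ 2 *
     (1 - embZ Z * (\<Sum>e=0..m. emb U ^ e * of_nat (m + 1 - e)))"
proof -
  have "X ^ 2 * emb (I_gf m) = emb (K (m + 1))"
    unfolding I_eq_K[symmetric] X_def by (simp only: emb.mult emb.power)
  then show ?thesis unfolding emb_K emb_c by (simp add: H_def)
qed

lemma I_formula':
  "X ^ 2 * emb (I_gf m) =
     embZ Z * emb U ^ (m + 2) / (1 - of_nat (m + 1) * embZ Z) * ((X - 1) / (emb U - 1))"
proof -
  have "X ^ 2 * emb (I_gf m) = emb (K (m + 1))"
    unfolding I_eq_K[symmetric] X_def by (simp only: emb.mult emb.power)
  moreover have "emb U \<noteq> 1" using U_neq_1 emb_eq_iff[of U 1] by (simp add: emb.one)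
  moreover have "(emb U - 1) * emb (K (m + 1)) = embZ Z * emb U ^ (m + 2) * (1 / emb c) * (X - 1)"
    using arg_cong[OF K_top, of emb]
    by (simp only: emb.mult emb.diff emb.one emb.power emb_c_inv embZ_eq z_def X_def)
  ultimately have "X ^ 2 * emb (I_gf m) = embZ Z * emb U ^ (m + 2) * (1 / emb c) * (X - 1) / (emb U - 1)"
    by (simp only: eq_divide_eq) (simp add: mult.commute)
  then show ?thesis unfolding emb_c by simp
qed

lemma I_at_1:
  "at_x1 (I_gf m) =
     Z / (1 - of_nat (m + 1) * Z) ^ 2 * (1 - of_nat ((m + 2) choose 2) * Z)"
proof -
  let ?C = "1 - of_nat (m + 1) * Z"
  have C0: "fps_nth ?C 0 \<noteq> 0" by (simp add: Z0)
  have "at_x1 (I_gf m) = at_x1 (K (m + 1))"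
    unfolding I_eq_K[symmetric] by (rule at_x1_x_series_power[symmetric])
  also have "\<dots> = Z * inverse ?C ^ 2 * H m (m + 1) Z 1"
    unfolding K_def
    by (simp add: at_x1.mult at_x1.power at_x1.H at_x1_z at_x1_U at_x1_lift c_inv_def at_x1.one)
  also have "inverse ?C ^ 2 = inverse (?C ^ 2)" by (rule fps_inverse_power[symmetric])
  also have "Z * inverse (?C ^ 2) = Z / ?C ^ 2"
    using C0 by (intro fps_divide_unit[symmetric]) (simp add: fps_nth_power_0)
  finally show ?thesis by (simp only: H_at_1)
qed

lemma J_formula:
  assumes "i \<le> m + 1"
  shows "emb (J_gf m i) / X powi (int m - int i - 1) =
    embZ Z * (1 - of_nat (m + 1) * embZ Z) powi (int m - int i - 1) * H m i (embZ Z) (emb U)"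
proof -
  have quotient: "a / (q / p) = k" if "p * a = q * k" "p \<noteq> 0" "q \<noteq> 0" for a k p q :: frac_series
    using that by (simp add: field_simps)
  have J: "X ^ (i + 1) * emb (J_gf m i) = X ^ m * emb (K i)"
    using arg_cong[OF J_eq_K[OF assms], of emb] by (simp only: emb.mult emb.power X_def)
  \<comment> \<open>The exponent may be negative, so it is split into a quotient of natural
    powers.\<close>
  have pow: "X powi (int m - int i - 1) = X ^ m / X ^ (i + 1)"
  proof -
    have "int m - int i - 1 = int m - int (i + 1)" by simp
    then show ?thesis
      using power_int_diff[of X "int m" "int (i + 1)"] X_neq_0 by (simp only: power_int_of_nat) simp
  qed
  have "emb (J_gf m i) / X powi (int m - int i - 1) = emb (K i)"
    unfolding pow using X_neq_0 by (intro quotient J) simp_all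
  moreover have "emb c powi (int m - int i - 1) = emb c ^ (m + 1 - i) / emb c ^ 2"
  proof -
    have "int m - int i - 1 = int (m + 1 - i) - int 2" using assms by simp
    then show ?thesis
      using power_int_diff[of "emb c" "int (m + 1 - i)" "int 2"] emb_c_neq_0
      by (simp only: power_int_of_nat) simp
  qed
  ultimately show ?thesis unfolding emb_K emb_c by simp
qed

end

theorem theorem4p1:
  fixes m :: nat
  assumes "1 \<le> m"
  shows
    "(\<exists>!Z. is_Z m Z) \<and>
     (\<forall>Z. is_Z m Z \<longrightarrow>
        (\<exists>!U. is_U m Z U) \<and>
        (\<forall>U. is_U m Z U \<longrightarrow>
           X ^ 2 * emb (I_gf m) =
             embZ Z * emb U ^ (m + 2) / (1 - of_nat (m + 1) * embZ Z) ^ 2 *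
             (1 - embZ Z * (\<Sum>e=0..m. emb U ^ e * of_nat (m + 1 - e))) \<and>
           X ^ 2 * emb (I_gf m) =
             embZ Z * emb U ^ (m + 2) / (1 - of_nat (m + 1) * embZ Z) *
             ((X - 1) / (emb U - 1)) \<and>
           at_x1 (I_gf m) =
             Z / (1 - of_nat (m + 1) * Z) ^ 2 * (1 - of_nat ((m + 2) choose 2) * Z) \<and>
           (\<forall>i \<le> m + 1.
              emb (J_gf m i) / X powi (int m - int i - 1) =
              embZ Z * (1 - of_nat (m + 1) * embZ Z) powi (int m - int i - 1) *
              H m i (embZ Z) (emb U))))"
proof (intro conjI allI impI)
  show "\<exists>!Z. is_Z m Z" by (rule is_Z_unique)
next
  fix Z assume Z: "is_Z m Z"
  then have "fps_nth (lift Z) 0 = 0" by (simp add: is_Z_def lift_def)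
  then show "\<exists>!U. is_U m Z U"
    unfolding is_U_iff[OF Z] by (rule kernel_equation_unique)
  fix U assume U: "is_U m Z U"
  interpret greedy_tamari_parametrisation m Z U
    using Z U by unfold_locales
  show "X ^ 2 * emb (I_gf m) =
      embZ Z * emb U ^ (m + 2) / (1 - of_nat (m + 1) * embZ Z) ^ 2 *
      (1 - embZ Z * (\<Sum>e=0..m. emb U ^ e * of_nat (m + 1 - e)))"
    by (rule I_formula)
  show "X ^ 2 * emb (I_gf m) =
      embZ Z * emb U ^ (m + 2) / (1 - of_nat (m + 1) * embZ Z) * ((X - 1) / (emb U - 1))"
    by (rule I_formula')
  show "at_x1 (I_gf m) =
      Z / (1 - of_nat (m + 1) * Z) ^ 2 * (1 - of_nat ((m + 2) choose 2) * Z)"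
    by (rule I_at_1)
  show "emb (J_gf m i) / X powi (int m - int i - 1) =
      embZ Z * (1 - of_nat (m + 1) * embZ Z) powi (int m - int i - 1) * H m i (embZ Z) (emb U)"
    if "i \<le> m + 1" for i
    using that by (rule J_formula)
qed

end
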